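(* Let $d,a,b,c_1,c_2$ be positive integers with $d\mid q-1$, let $\lambda_1,\lambda_2\in\kappa^\times\setminus\{1\}$, and let $S_{4,\lambda}$ be the affine surface over $\kappa$ defined by $$y^d=x_1^{\langle a\rangle}x_2^{\langle b\rangle}(1-x_1)^{\langle c_1-a\rangle}(1-x_2)^{\langle c_2-b\rangle}(1-\lambda_1x_1)^{\langle a-c_1-c_2\rangle}(1-\lambda_2x_2)^{\langle b-c_1-c_2\rangle}(1-\lambda_1x_1-\lambda_2x_2)^{\langle c_1+c_2-a-b\rangle},$$ where, for $k\in\mathbb{Z}$, $\langle k\rangle\in\{0,\dots,d-1\}$ denotes the representative of $k$ modulo $d$, with $\mu_d$ acting by $\xi\cdot(x_1,x_2,y)=(x_1,x_2,\xi y)$. Suppose that $\gcd(d,a)=\gcd(d,b)=\gcd(d,c_i-a)=\gcd(d,c_i-b)=1$ for $i=1,2$. Then, for $m\in\mathbb{Z}/d\mathbb{Z}$, $$N_1(S_{4,\lambda};\chi^m)=\begin{cases}q^2&(m=0),\\ J\cdot F_4\big(\varphi_d^{ma};\varphi_d^{mb};\varphi_d^{mc_1},\varphi_d^{mc_2};\lambda_1(1-\lambda_2),\lambda_2(1-\lambda_1)\big)+\sum_{i=0}^2S_i(\lambda_1,\lambda_2)&(m\neq0),\end{cases}$$ where, with $\alpha=\varphi_d^{ma}$, $\beta=\varphi_d^{mb}$, $\gamma_i=\varphi_d^{mc_i}$, $$J=j(\alpha,\overline{\alpha}\gamma_1)\,j(\beta,\overline{\beta}\gamma_2),$$ $$S_0(x,y)=\alpha\beta(-1)\,j(\alpha\overline{\gamma_2},\beta\overline{\gamma_1})\,\overline{\gamma_1}(x)\,\overline{\gamma_2}(y),$$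 $$S_1(x,y)=j(\overline{\alpha\beta}\gamma_1\gamma_2,\beta)\,\overline{\gamma_1}(x)\,\overline{\alpha}\gamma_1(x-1)\,\overline{\beta}(y),$$ $$S_2(x,y)=j(\overline{\alpha\beta}\gamma_1\gamma_2,\alpha)\,\overline{\gamma_2}(y)\,\overline{\beta}\gamma_2(y-1)\,\overline{\alpha}(x).$$
   Context: $\kappa$ is a finite field with $q$ elements of characteristic $p$. $\widehat{\kappa^\times}=\mathrm{Hom}(\kappa^\times,\overline{\mathbb{Q}}^\times)$ is the group of multiplicative characters, $\varepsilon$ the trivial character, $\overline{\eta}=\eta^{-1}$; every $\eta\in\widehat{\kappa^\times}$ (including $\varepsilon$) is extended to $\kappa$ by $\eta(0)=0$. A product of characters followed by an argument means the product character evaluated there. $\delta(\eta)=1$ if $\eta=\varepsilon$ and $0$ otherwise. Fix a non-trivial additive character $\psi\in\mathrm{Hom}(\kappa,\overline{\mathbb{Q}}^\times)$. Put $$g(\eta)=-\sum_{x\in\kappa^\times}\psi(x)\eta(x),\quad g^\circ(\eta)=q^{\delta(\eta)}g(\eta),\quad j(\eta_1,\eta_2)=-\sum_{x_1,x_2\in\kappa^\times,\ x_1+x_2=1}\eta_1(x_1)\eta_2(x_2),$$ $$(\alpha)_\nu=\frac{g(\alpha\nu)}{g(\alpha)},\qquad(\alpha)_\nu^\circ=\frac{g^\circ(\alpha\nu)}{g^\circ(\alpha)},$$ $$F_4(\alpha;\beta;\gamma_1,\gamma_2;\lambda_1,\lambda_2)=\frac{1}{(1-q)^2}\sum_{\nu_1,\nu_2\in\widehat{\kappa^\times}}\frac{(\alpha)_{\nu_1\nu_2}(\beta)_{\nu_1\nu_2}}{(\gamma_1)^\circ_{\nu_1}(\gamma_2)^\circ_{\nu_2}(\varepsilon)^\circ_{\nu_1}(\varepsilon)^\circ_{\nu_2}}\nu_1(\lambda_1)\nu_2(\lambda_2).$$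 $\mu_d\subset\kappa^\times$ is the group of $d$th roots of unity. Fix a generator $\varphi$ of $\widehat{\kappa^\times}$ and put $\varphi_d=\varphi^{(q-1)/d}$, $\chi=\varphi|_{\mu_d}$, so that $\widehat{\mu_d}=\{\chi^m\mid m\in\mathbb{Z}/d\mathbb{Z}\}$. For a variety $V$ over $\kappa$ with an action over $\kappa$ of a finite abelian group $G$, with $F$ the $q$-Frobenius on $V(\overline{\kappa})$ ($\overline{\kappa}$ a fixed algebraic closure of $\kappa$), and for $\theta\in\mathrm{Hom}(G,\overline{\mathbb{Q}}^\times)$ and $r\ge1$, $$N_r(V;\theta)=\frac{1}{\#G}\sum_{g\in G}\theta(g)\,\#\{x\in V(\overline{\kappa})\mid F^r(x)=g(x)\}.$$
   Formalization: For m≠0 the formula is asserted only if d divides none of a−c₁−c₂, b−c₁−c₂, c₁+c₂−a−b (it fails e.g. for q=5, d=2, a=b=m=1, c₁=c₂=λ₁=λ₂=2: 4≠3); with ⟨k⟩ taken in {1,…,d} instead it is proved without this restriction. *)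

theory Defs
  imports "HOL-Algebra.Algebraic_Closure_Type" "HOL-Library.Cardinality"
begin

type_synonym qbar = "rat alg_closure"

section \<open>Characters of a finite field\<close>

text \<open>
  A multiplicative character is represented by its extension by \<open>0\<close> to the whole field.
  Values at non-zero arguments are then automatically units, and the conditions below say
  exactly that the restriction to the units is a homomorphism into the units of \<open>qbar\<close>.
\<close>

definition mult_chars :: "('k::{finite,field} \<Rightarrow> qbar) set" where
  "mult_chars = {\<eta>. \<eta> 0 = 0 \<and> \<eta> 1 = 1 \<and> (\<forall>x y. \<eta> (x * y) = \<eta> x * \<eta> y)}"

definition triv_char :: "'k::{finite,field} \<Rightarrow> qbar" where
  "triv_char x = (if x = 0 then 0 else 1)"

definition char_mult :: "('k::{finite,field} \<Rightarrow> qbar) \<Rightarrow> ('k \<Rightarrow> qbar) \<Rightarrow> 'k \<Rightarrow> qbar"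
    (infixl \<open>\<odot>\<close> 70) where
  "(\<alpha> \<odot> \<beta>) x = \<alpha> x * \<beta> x"

definition char_inv :: "('k::{finite,field} \<Rightarrow> qbar) \<Rightarrow> 'k \<Rightarrow> qbar" where
  "char_inv \<alpha> x = inverse (\<alpha> x)"

text \<open>The case distinction keeps the value \<open>0\<close> at \<open>0\<close> for the exponent \<open>0\<close> as well.\<close>

definition char_pow :: "('k::{finite,field} \<Rightarrow> qbar) \<Rightarrow> int \<Rightarrow> 'k \<Rightarrow> qbar" where
  "char_pow \<alpha> n x = (if x = 0 then 0 else \<alpha> x powi n)"

definition char_generator :: "('k::{finite,field} \<Rightarrow> qbar) \<Rightarrow> bool" where
  "char_generator \<phi> \<longleftrightarrow> \<phi> \<in> mult_chars \<and> (\<forall>\<eta>\<in>mult_chars. \<exists>n. \<eta> = char_pow \<phi> n)"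

definition add_chars :: "('k::{finite,field} \<Rightarrow> qbar) set" where
  "add_chars = {\<psi>. \<psi> 0 = 1 \<and> (\<forall>x y. \<psi> (x + y) = \<psi> x * \<psi> y)}"


section \<open>Gauss and Jacobi sums, Pochhammer symbols, Appell's function over a finite field\<close>

definition gauss :: "('k::{finite,field} \<Rightarrow> qbar) \<Rightarrow> ('k \<Rightarrow> qbar) \<Rightarrow> qbar" where
  "gauss \<psi> \<eta> = - (\<Sum>x\<in>UNIV - {0}. \<psi> x * \<eta> x)"

definition gauss0 :: "('k::{finite,field} \<Rightarrow> qbar) \<Rightarrow> ('k \<Rightarrow> qbar) \<Rightarrow> qbar" where
  "gauss0 \<psi> \<eta> = of_nat CARD('k) ^ (if \<eta> = triv_char then 1 else 0) * gauss \<psi> \<eta>"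

definition jacobi :: "('k::{finite,field} \<Rightarrow> qbar) \<Rightarrow> ('k \<Rightarrow> qbar) \<Rightarrow> qbar" where
  "jacobi \<eta>\<^sub>1 \<eta>\<^sub>2 = - (\<Sum>(x\<^sub>1, x\<^sub>2)\<in>{(x\<^sub>1, x\<^sub>2). x\<^sub>1 \<noteq> 0 \<and> x\<^sub>2 \<noteq> 0 \<and> x\<^sub>1 + x\<^sub>2 = 1}. \<eta>\<^sub>1 x\<^sub>1 * \<eta>\<^sub>2 x\<^sub>2)"

definition poch :: "('k::{finite,field} \<Rightarrow> qbar) \<Rightarrow> ('k \<Rightarrow> qbar) \<Rightarrow> ('k \<Rightarrow> qbar) \<Rightarrow> qbar" where
  "poch \<psi> \<alpha> \<nu> = gauss \<psi> (\<alpha> \<odot> \<nu>) / gauss \<psi> \<alpha>"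

definition poch0 :: "('k::{finite,field} \<Rightarrow> qbar) \<Rightarrow> ('k \<Rightarrow> qbar) \<Rightarrow> ('k \<Rightarrow> qbar) \<Rightarrow> qbar" where
  "poch0 \<psi> \<alpha> \<nu> = gauss0 \<psi> (\<alpha> \<odot> \<nu>) / gauss0 \<psi> \<alpha>"

definition appell_F4 ::
  "('k::{finite,field} \<Rightarrow> qbar) \<Rightarrow> ('k \<Rightarrow> qbar) \<Rightarrow> ('k \<Rightarrow> qbar) \<Rightarrow> ('k \<Rightarrow> qbar) \<Rightarrow> ('k \<Rightarrow> qbar)
     \<Rightarrow> 'k \<Rightarrow> 'k \<Rightarrow> qbar" where
  "appell_F4 \<psi> \<alpha> \<beta> \<gamma>\<^sub>1 \<gamma>\<^sub>2 l\<^sub>1 l\<^sub>2 =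
     1 / (1 - of_nat CARD('k))\<^sup>2 *
     (\<Sum>\<nu>\<^sub>1\<in>mult_chars. \<Sum>\<nu>\<^sub>2\<in>mult_chars.
        (poch \<psi> \<alpha> (\<nu>\<^sub>1 \<odot> \<nu>\<^sub>2) * poch \<psi> \<beta> (\<nu>\<^sub>1 \<odot> \<nu>\<^sub>2)) /
        (poch0 \<psi> \<gamma>\<^sub>1 \<nu>\<^sub>1 * poch0 \<psi> \<gamma>\<^sub>2 \<nu>\<^sub>2 * poch0 \<psi> triv_char \<nu>\<^sub>1 * poch0 \<psi> triv_char \<nu>\<^sub>2)
        * \<nu>\<^sub>1 l\<^sub>1 * \<nu>\<^sub>2 l\<^sub>2)"


section \<open>Twisted point counts\<close>

text \<open>
  \<open>V\<close> is the set of geometric points of a variety, \<open>F\<close> its Frobenius, and \<open>act\<close> the action of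
  the finite abelian group with underlying set \<open>G\<close>.
\<close>

definition twisted_count ::
  "('v \<Rightarrow> 'v) \<Rightarrow> 'g set \<Rightarrow> ('g \<Rightarrow> 'v \<Rightarrow> 'v) \<Rightarrow> nat \<Rightarrow> 'v set \<Rightarrow> ('g \<Rightarrow> qbar) \<Rightarrow> qbar" where
  "twisted_count F G act r V \<theta> =
     1 / of_nat (card G) * (\<Sum>g\<in>G. \<theta> g * of_nat (card {x \<in> V. (F ^^ r) x = act g x}))"

type_synonym 'k point3 = "'k alg_closure \<times> 'k alg_closure \<times> 'k alg_closure"

definition frob3 :: "'k::{finite,field} point3 \<Rightarrow> 'k point3" where
  "frob3 = (\<lambda>(x\<^sub>1, x\<^sub>2, y). (x\<^sub>1 ^ CARD('k), x\<^sub>2 ^ CARD('k), y ^ CARD('k)))"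

definition roots_of_unity :: "nat \<Rightarrow> 'k::{finite,field} set" where
  "roots_of_unity d = {\<xi>. \<xi> ^ d = 1}"

definition mu_act :: "'k::{finite,field} \<Rightarrow> 'k point3 \<Rightarrow> 'k point3" where
  "mu_act \<xi> = (\<lambda>(x\<^sub>1, x\<^sub>2, y). (x\<^sub>1, x\<^sub>2, to_ac \<xi> * y))"


section \<open>The surface\<close>

definition residue :: "nat \<Rightarrow> int \<Rightarrow> nat" where
  "residue d k = nat (k mod int d)"

text \<open>
  The representative in \<open>{1..d}\<close>. It differs from \<open>residue\<close> only for multiples of \<open>d\<close>, where a
  factor raised to the power \<open>residue d k = 0\<close> would disappear from the equation of the surface,
  whereas the trivial character of that factor vanishes at its zeros.
\<close>

definition pos_residue :: "nat \<Rightarrow> int \<Rightarrow> nat" where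
  "pos_residue d k = (if int d dvd k then d else residue d k)"

definition surface4 ::
  "(int \<Rightarrow> nat) \<Rightarrow> nat \<Rightarrow> int \<Rightarrow> int \<Rightarrow> int \<Rightarrow> int \<Rightarrow> 'k::{finite,field} \<Rightarrow> 'k \<Rightarrow> 'k point3 set" where
  "surface4 rep d a b c\<^sub>1 c\<^sub>2 l\<^sub>1 l\<^sub>2 =
     {(x\<^sub>1, x\<^sub>2, y). y ^ d =
        x\<^sub>1 ^ rep a * x\<^sub>2 ^ rep b * (1 - x\<^sub>1) ^ rep (c\<^sub>1 - a) * (1 - x\<^sub>2) ^ rep (c\<^sub>2 - b)
        * (1 - to_ac l\<^sub>1 * x\<^sub>1) ^ rep (a - c\<^sub>1 - c\<^sub>2) * (1 - to_ac l\<^sub>2 * x\<^sub>2) ^ rep (b - c\<^sub>1 - c\<^sub>2)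
        * (1 - to_ac l\<^sub>1 * x\<^sub>1 - to_ac l\<^sub>2 * x\<^sub>2) ^ rep (c\<^sub>1 + c\<^sub>2 - a - b)}"


section \<open>The correction terms\<close>

definition S\<^sub>0 ::
  "('k::{finite,field} \<Rightarrow> qbar) \<Rightarrow> ('k \<Rightarrow> qbar) \<Rightarrow> ('k \<Rightarrow> qbar) \<Rightarrow> ('k \<Rightarrow> qbar) \<Rightarrow> 'k \<Rightarrow> 'k \<Rightarrow> qbar" where
  "S\<^sub>0 \<alpha> \<beta> \<gamma>\<^sub>1 \<gamma>\<^sub>2 x y =
     (\<alpha> \<odot> \<beta>) (-1) * jacobi (\<alpha> \<odot> char_inv \<gamma>\<^sub>2) (\<beta> \<odot> char_inv \<gamma>\<^sub>1) * char_inv \<gamma>\<^sub>1 x * char_inv \<gamma>\<^sub>2 y"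

definition S\<^sub>1 ::
  "('k::{finite,field} \<Rightarrow> qbar) \<Rightarrow> ('k \<Rightarrow> qbar) \<Rightarrow> ('k \<Rightarrow> qbar) \<Rightarrow> ('k \<Rightarrow> qbar) \<Rightarrow> 'k \<Rightarrow> 'k \<Rightarrow> qbar" where
  "S\<^sub>1 \<alpha> \<beta> \<gamma>\<^sub>1 \<gamma>\<^sub>2 x y =
     jacobi (char_inv (\<alpha> \<odot> \<beta>) \<odot> \<gamma>\<^sub>1 \<odot> \<gamma>\<^sub>2) \<beta>
     * char_inv \<gamma>\<^sub>1 x * (char_inv \<alpha> \<odot> \<gamma>\<^sub>1) (x - 1) * char_inv \<beta> y"

definition S\<^sub>2 ::
  "('k::{finite,field} \<Rightarrow> qbar) \<Rightarrow> ('k \<Rightarrow> qbar) \<Rightarrow> ('k \<Rightarrow> qbar) \<Rightarrow> ('k \<Rightarrow> qbar) \<Rightarrow> 'k \<Rightarrow> 'k \<Rightarrow> qbar" where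
  "S\<^sub>2 \<alpha> \<beta> \<gamma>\<^sub>1 \<gamma>\<^sub>2 x y =
     jacobi (char_inv (\<alpha> \<odot> \<beta>) \<odot> \<gamma>\<^sub>1 \<odot> \<gamma>\<^sub>2) \<alpha>
     * char_inv \<gamma>\<^sub>2 y * (char_inv \<beta> \<odot> \<gamma>\<^sub>2) (y - 1) * char_inv \<alpha> x"

end

theory Submission
  imports Defs
begin

text \<open>
  Both sides are turned into sums over pairs of elements of the finite field \<open>\<kappa>\<close>, and a birational
  change of variables matches the two sums.

  The left-hand side. A fixed point of \<open>\<xi>\<^sup>-\<^sup>1F\<close> on the surface has \<open>x\<^sub>1\<close> and \<open>x\<^sub>2\<close> in \<open>\<kappa>\<close>. If \<open>c \<noteq> 0\<close> is the value
  of the right-hand side of the equation at \<open>(x\<^sub>1, x\<^sub>2)\<close>, then each of the \<open>d\<close> solutions of \<open>y\<^sup>d = c\<close>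
  satisfies \<open>y\<^sup>q = \<xi>y\<close> for exactly one \<open>\<xi>\<close>, namely for \<open>\<xi> = c\<close> to the power \<open>(q - 1) / d\<close>. If \<open>c = 0\<close>, the
  only point \<open>y = 0\<close> is fixed for every \<open>\<xi>\<close>, and the sum of \<open>\<chi>\<^sup>m\<close> over \<open>\<mu>\<^sub>d\<close> decides. Hence the twisted
  count is \<open>q\<^sup>2\<close> for \<open>m = 0\<close> and otherwise the sum of \<open>\<phi>\<^sub>d\<^sup>m(c)\<close> over all \<open>(x\<^sub>1, x\<^sub>2)\<close>, which is a product of
  seven characters of linear forms (\<open>twisted_count_surface4\<close>).

  The right-hand side. Written in Gauss sums, the coefficient of \<open>\<nu>\<^sub>1(w\<^sub>1)\<nu>\<^sub>2(w\<^sub>2)\<close> in Appell's function is, up to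
  a constant, a product of six of them, two of which contain both \<open>\<nu>\<^sub>1\<close> and \<open>\<nu>\<^sub>2\<close>. Let \<open>s\<close> and \<open>t\<close> be the summation variables of
  these two. The sums over \<open>\<nu>\<^sub>1\<close> and \<open>\<nu>\<^sub>2\<close> of the other four are Mellin inversions and give Kloosterman
  sums in \<open>stw\<^sub>1\<close> and \<open>stw\<^sub>2\<close>. Scaling the variable of the first by \<open>s\<close> and that of the second by \<open>t\<close>
  makes the argument of \<open>\<psi>\<close> linear in \<open>s\<close> and in \<open>t\<close>; the sums over \<open>s\<close> and \<open>t\<close> are then Gauss sums,
  and all Gauss sums cancel against the factor \<open>J\<close>. What remains, up to the sign \<open>\<alpha>\<beta>(-1)\<close>, is the double sum of \<open>F4_kernel\<close>
  (\<open>jacobi_mult_appell_F4\<close>).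

  The comparison. For \<open>w\<^sub>1 = l\<^sub>1(1 - l\<^sub>2)\<close> and \<open>w\<^sub>2 = l\<^sub>2(1 - l\<^sub>1)\<close> the substitution \<open>u = -(1 - l\<^sub>2y)/x\<close>,
  \<open>v = -(1 - l\<^sub>1x)/y\<close> carries the kernel to the character of the surface. Where neither
  \<open>x\<close>, \<open>y\<close>, \<open>1 - l\<^sub>1x\<close>, \<open>1 - l\<^sub>2y\<close> nor \<open>1 - l\<^sub>1x - l\<^sub>2y\<close> vanishes, it is a bijection onto the
  pairs of non-zero \<open>u\<close>, \<open>v\<close> off the three curves \<open>u = -l\<^sub>1\<close>, \<open>v = -l\<^sub>2\<close> and \<open>uv = l\<^sub>1l\<^sub>2\<close>. Any two of these
  curves meet only at \<open>(-l\<^sub>1, -l\<^sub>2)\<close>, where the kernel is zero, and along each of them the kernel sums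
  to a multiple of a single Jacobi sum. These three sums give the correction terms (\<open>sum_surface_char\<close>).
\<close>

(* Keeps the infix symbol of the product of characters unambiguous. *)
no_notation Module.smult (infixl "\<odot>\<index>" 70)

section \<open>Finite fields and roots of unity\<close>

text \<open>
  A double root would be a common root of \<open>z\<^sup>n - c\<close> and its derivative \<open>nz\<^sup>n\<^sup>-\<^sup>1\<close>, hence \<open>0\<close>.
\<close>

lemma card_roots_of_power_eq:
  fixes c :: "'a :: alg_closed_field"
  assumes "n > 0" and "of_nat n \<noteq> (0 :: 'a)" and "c \<noteq> 0"
  shows "card {z. z ^ n = c} = n"
proof -
  define p where "p = Polynomial.monom 1 n - [:c:]"
  have pz: "poly p z = z ^ n - c" for z
    by (simp add: p_def poly_monom)
  have deg: "Polynomial.degree p = n"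
  proof (rule antisym)
    show "Polynomial.degree p \<le> n"
      unfolding p_def by (rule degree_diff_le) (auto simp: degree_monom_le)
    show "n \<le> Polynomial.degree p"
      using assms(1) by (intro le_degree) (simp add: p_def coeff_pCons split: nat.split)
  qed
  hence p0: "p \<noteq> 0"
    using assms(1) by auto
  have lc: "Polynomial.lead_coeff p = 1"
    unfolding deg using assms(1) by (simp add: p_def coeff_pCons split: nat.split)
  obtain A where A: "size A = n" "p = (\<Prod>x\<in>#A. [:-x, 1:])"
    using alg_closed_imp_factorization[OF p0] deg lc by auto
  \<comment> \<open>\<open>A\<close> is the multiset of roots.\<close>
  have dist: "count A a = 1" if a: "a \<in># A" for a
  proof (rule ccontr)
    assume "count A a \<noteq> 1"
    with a have "a \<in># A - {#a#}"
      by (metis add_mset_remove_trivial_eq count_add_mset count_eq_zero_iff One_nat_def)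
    then obtain B where B: "A = add_mset a (add_mset a B)"
      by (metis a insert_DiffM)
    define r where "r = (\<Prod>x\<in>#B. [:-x, 1:])"
    have p_eq: "p = [:-a, 1:] * ([:-a, 1:] * r)"
      unfolding A(2) B r_def by simp
    have "poly (pderiv p) a = 0" "poly p a = 0"
      unfolding p_eq pderiv_mult poly_add poly_mult by simp_all
    moreover have "poly (pderiv p) a = of_nat n * a ^ (n - 1)"
      unfolding p_def pderiv_diff pderiv_monom poly_diff poly_monom
      by (simp add: pderiv_pCons)
    ultimately have "a = 0" "a ^ n = c"
      using assms(2) by (auto simp: pz)
    thus False
      using assms(1,3) by auto
  qed
  have "poly p z = 0 \<longleftrightarrow> z \<in># A" for z
    unfolding A(2) by (auto simp: poly_prod_mset prod_mset_zero_iff)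
  hence "{z. z ^ n = c} = set_mset A"
    by (auto simp: pz)
  moreover have "size A = card (set_mset A)"
    using dist by (simp add: size_multiset_overloaded_eq)
  ultimately show ?thesis
    using A(1) by simp
qed

lemma card_roots_of_power_le:
  fixes c :: "'a :: field"
  assumes "n > 0"
  shows "finite {z. z ^ n = c}" and "card {z. z ^ n = c} \<le> n"
proof -
  define p where "p = Polynomial.monom 1 n - [:c:]"
  have pz: "poly p z = z ^ n - c" for z
    by (simp add: p_def poly_monom)
  have deg: "Polynomial.degree p = n"
  proof (rule antisym)
    show "Polynomial.degree p \<le> n"
      unfolding p_def by (rule degree_diff_le) (auto simp: degree_monom_le)
    show "n \<le> Polynomial.degree p"
      using assms(1) by (intro le_degree) (simp add: p_def coeff_pCons split: nat.split)
  qed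
  hence p0: "p \<noteq> 0"
    using assms(1) by auto
  have *: "{z. z ^ n = c} = {z. poly p z = 0}"
    by (auto simp: pz)
  show "finite {z. z ^ n = c}" "card {z. z ^ n = c} \<le> n"
    using poly_roots_finite[OF p0] card_poly_roots_bound[OF p0] unfolding * deg by auto
qed

lemma card_field_ge_2: "CARD('k::{finite,field}) \<ge> 2"
  using card_mono[of "UNIV :: 'k set" "{0, 1}"] by simp

lemma card_nonzero: "card (UNIV - {0 :: 'k::{finite,field}}) = CARD('k) - 1"
  by (simp add: card_Diff_subset)

lemma power_card_minus_1:
  fixes x :: "'k::{finite,field}"
  assumes "x \<noteq> 0"
  shows "x ^ (CARD('k) - 1) = 1"
proof -
  have "(\<Prod>y\<in>UNIV-{0::'k}. x * y) = (\<Prod>y\<in>UNIV-{0}. y)"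
    by (rule prod.reindex_bij_witness[of _ "\<lambda>y. y / x" "\<lambda>y. x * y"]) (use assms in auto)
  hence "x ^ (CARD('k) - 1) * (\<Prod>y\<in>UNIV-{0::'k}. y) = (\<Prod>y\<in>UNIV-{0}. y)"
    by (simp add: prod.distrib card_nonzero)
  thus ?thesis
    by simp
qed

lemma power_card:
  fixes x :: "'k::{finite,field}"
  shows "x ^ CARD('k) = x"
proof (cases "x = 0")
  case False
  have "x ^ CARD('k) = x * x ^ (CARD('k) - 1)"
    using power_Suc[of x "CARD('k) - 1"] by (simp only: Suc_diff_1[OF zero_less_card_finite])
  thus ?thesis
    using power_card_minus_1[OF False] by simp
qed (simp add: card_gt_0_iff)

lemma of_nat_card_eq_0: "of_nat CARD('k) = (0 :: 'k::{finite,field})"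
proof -
  have "(\<Sum>x\<in>(UNIV::'k set). x + 1) = (\<Sum>x\<in>UNIV. x)"
    by (rule sum.reindex_bij_witness[of _ "\<lambda>x. x - 1" "\<lambda>x. x + 1"]) auto
  thus ?thesis
    by (simp add: sum.distrib)
qed

lemma of_nat_dvd_card_minus_1_neq_0:
  assumes "d dvd CARD('k::{finite,field}) - 1"
  shows "of_nat d \<noteq> (0 :: 'k)"
proof
  assume "of_nat d = (0 :: 'k)"
  moreover from assms obtain e where "CARD('k) - 1 = d * e" ..
  ultimately have "of_nat (CARD('k) - 1) = (0 :: 'k)"
    by simp
  moreover have "of_nat (CARD('k) - 1) = (of_nat CARD('k) - 1 :: 'k)"
    using card_field_ge_2[where 'k = 'k] by (subst of_nat_diff) auto
  ultimately show False
    by (simp add: of_nat_card_eq_0)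
qed

text \<open>
  The elements of the base field already account for all of the at most \<open>q\<close> roots of \<open>z\<^sup>q - z\<close>.
\<close>

lemma frobenius_fixed_iff:
  fixes z :: "'k::{finite,field} alg_closure"
  shows "z ^ CARD('k) = z \<longleftrightarrow> z \<in> range to_ac"
proof -
  define q where "q = CARD('k)"
  have q: "q \<ge> 2"
    unfolding q_def by (rule card_field_ge_2)
  have iff: "w ^ q = w \<longleftrightarrow> w = 0 \<or> w ^ (q - 1) = 1" for w :: "'k alg_closure"
  proof -
    have "w ^ q = w * w ^ (q - 1)"
      using q by (metis Suc_diff_1 Suc_le_lessD numeral_2_eq_2 power_Suc zero_less_Suc order.strict_trans)
    thus ?thesis
      by auto
  qed
  have sub: "range to_ac \<subseteq> {w :: 'k alg_closure. w ^ q = w}"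
  proof
    fix w :: "'k alg_closure" assume "w \<in> range to_ac"
    then obtain x where "w = to_ac x" ..
    thus "w \<in> {w. w ^ q = w}"
      using to_ac_power[of x q] power_card[of x] by (simp add: q_def)
  qed
  have fin: "finite {w :: 'k alg_closure. w ^ (q - 1) = 1}"
    and le: "card {w :: 'k alg_closure. w ^ (q - 1) = 1} \<le> q - 1"
    using card_roots_of_power_le[of "q - 1" "1 :: 'k alg_closure"] q by auto
  have eq: "{w :: 'k alg_closure. w ^ q = w} = insert 0 {w. w ^ (q - 1) = 1}"
    using iff by auto
  have "card {w :: 'k alg_closure. w ^ q = w} \<le> q"
    unfolding eq using le q card_insert_le_m1[of q "{w :: 'k alg_closure. w ^ (q - 1) = 1}" 0] by simp
  also have "q = card (range (to_ac :: 'k \<Rightarrow> _))"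
    unfolding q_def by (simp add: card_image inj_to_ac)
  finally have "range to_ac = {w :: 'k alg_closure. w ^ q = w}"
    using sub fin eq by (intro card_seteq) auto
  thus ?thesis
    by (auto simp: q_def)
qed

text \<open>
  The theorem on finite subgroups of the units, transferred from the carrier-based field to the type class.
\<close>

lemma finite_field_units_cyclic:
  "\<exists>g :: 'k::{finite,field}. g \<noteq> 0 \<and> (\<forall>x. x \<noteq> 0 \<longrightarrow> (\<exists>i::nat. x = g ^ i))"
proof -
  define K where "K = (ring_of_type_algebra :: 'k ring)"
  interpret K: Ring.field K
    unfolding K_def by rule
  have carr: "carrier K = UNIV" and z: "\<zero>\<^bsub>K\<^esub> = 0" and o: "\<one>\<^bsub>K\<^esub> = 1"
    and m: "monoid.mult K = (\<lambda>x y. x * y)"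
    by (auto simp: K_def ring_of_type_algebra_def)
  have pw: "x [^]\<^bsub>K\<^esub> (i::nat) = x ^ i" for x :: 'k and i
  proof (induction i)
    case 0
    show ?case
      using K.nat_pow_0[of x] by (simp only: o power_0)
  next
    case (Suc i)
    show ?case
      using K.nat_pow_Suc[of x i] Suc by (simp only: m power_Suc2)
  qed
  have "finite (carrier K)"
    by (simp add: carr)
  hence "\<exists>g\<in>carrier (Multiplicative_Group.mult_of K). carrier (Multiplicative_Group.mult_of K) = {g [^]\<^bsub>K\<^esub> i |i::nat. i \<in> UNIV}"
    by (rule K.finite_field_mult_group_has_gen)
  then obtain g
    where "g \<in> carrier (Multiplicative_Group.mult_of K)" "carrier (Multiplicative_Group.mult_of K) = {g [^]\<^bsub>K\<^esub> i |i::nat. i \<in> UNIV}"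
    by (elim bexE)
  hence "g \<noteq> 0" "UNIV - {0} = {g ^ i |i::nat. True}"
    unfolding pw Multiplicative_Group.carrier_mult_of carr z by auto
  thus ?thesis
    by blast
qed

text \<open>
  A power of \<open>g\<close> depends only on the exponent modulo \<open>r = i mod (q - 1)\<close> once \<open>g\<^sup>r = 1\<close>, so \<open>r > 0\<close> would leave
  fewer than \<open>q - 1\<close> units.
\<close>

lemma primitive_power_eq_1:
  fixes g :: "'k::{finite,field}"
  assumes g: "g \<noteq> 0" "\<And>x. x \<noteq> 0 \<Longrightarrow> \<exists>i::nat. x = g ^ i" and i: "g ^ i = 1"
  shows "(CARD('k) - 1) dvd i"
proof -
  define n where "n = CARD('k) - 1"
  have n: "n > 0"
    using card_field_ge_2[where 'k = 'k] by (simp add: n_def)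
  define r where "r = i mod n"
  have "g ^ i = (g ^ n) ^ (i div n) * g ^ r"
    by (metis mult_div_mod_eq power_add power_mult r_def)
  hence r1: "g ^ r = 1"
    using i power_card_minus_1[OF g(1)] by (simp add: n_def)
  have "r = 0"
  proof (rule ccontr)
    assume "r \<noteq> 0"
    have "UNIV - {0} \<subseteq> (\<lambda>j. g ^ j) ` {..<r}"
    proof
      fix x :: 'k assume "x \<in> UNIV - {0}"
      then obtain j where "x = g ^ j"
        using g(2) by auto
      also have "\<dots> = (g ^ r) ^ (j div r) * g ^ (j mod r)"
        by (metis mult_div_mod_eq power_add power_mult)
      finally show "x \<in> (\<lambda>j. g ^ j) ` {..<r}"
        using r1 \<open>r \<noteq> 0\<close> by auto
    qed
    hence "n \<le> card ((\<lambda>j. g ^ j) ` {..<r})"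
      unfolding n_def card_nonzero[symmetric] by (intro card_mono) auto
    also have "\<dots> \<le> r"
      using card_image_le[of "{..<r}" "\<lambda>j. g ^ j"] by simp
    finally show False
      using n mod_less_divisor[of n i] unfolding r_def by linarith
  qed
  thus ?thesis
    unfolding n_def[symmetric] r_def by auto
qed

section \<open>Multiplicative characters\<close>

lemma triv_char_mem [simp]: "triv_char \<in> mult_chars"
  by (auto simp: mult_chars_def triv_char_def)

lemma char_mult_mem [simp]: "\<alpha> \<in> mult_chars \<Longrightarrow> \<beta> \<in> mult_chars \<Longrightarrow> \<alpha> \<odot> \<beta> \<in> mult_chars"
  by (auto simp: mult_chars_def char_mult_def)

lemma char_inv_mem [simp]: "\<alpha> \<in> mult_chars \<Longrightarrow> char_inv \<alpha> \<in> mult_chars"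
  by (auto simp: mult_chars_def char_inv_def)

lemma char_pow_mem [simp]: "\<alpha> \<in> mult_chars \<Longrightarrow> char_pow \<alpha> n \<in> mult_chars"
  by (auto simp: mult_chars_def char_pow_def power_int_mult_distrib)

text \<open>
  These rules have a variable as head symbol. They are harmless as rewrite rules as long as
  \<open>mult_chars_def\<close> is not unfolded at the same time, which is why the closure properties come first.
\<close>

lemma mult_char_0 [simp]: "\<eta> \<in> mult_chars \<Longrightarrow> \<eta> 0 = 0"
  and mult_char_1 [simp]: "\<eta> \<in> mult_chars \<Longrightarrow> \<eta> 1 = 1"
  and mult_char_mult [simp]: "\<eta> \<in> mult_chars \<Longrightarrow> \<eta> (x * y) = \<eta> x * \<eta> y"
  by (auto simp: mult_chars_def)

lemma mult_char_eq_0_iff [simp]: "\<eta> \<in> mult_chars \<Longrightarrow> \<eta> x = 0 \<longleftrightarrow> x = 0"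
  by (metis mult_char_0 mult_char_1 mult_char_mult mult_not_zero right_inverse zero_neq_one)

lemma mult_char_inverse [simp]:
  assumes "\<eta> \<in> mult_chars"
  shows "\<eta> (inverse x) = inverse (\<eta> x)"
proof (cases "x = 0")
  case False
  have "\<eta> x * \<eta> (inverse x) = 1"
    using assms False by (metis mult_char_1 mult_char_mult right_inverse)
  thus ?thesis
    by (simp add: inverse_unique)
qed (use assms in simp)

lemma mult_char_divide [simp]: "\<eta> \<in> mult_chars \<Longrightarrow> \<eta> (x / y) = \<eta> x / \<eta> y"
  by (simp add: divide_inverse)

lemma mult_char_power [simp]: "\<eta> \<in> mult_chars \<Longrightarrow> \<eta> (x ^ n) = \<eta> x ^ n"
  by (induction n) auto

lemma mult_char_uminus: "\<eta> \<in> mult_chars \<Longrightarrow> \<eta> (- x) = \<eta> (- 1) * \<eta> x"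
  using mult_char_mult[of \<eta> "-1" x] by simp

lemma mult_char_neg_one_square: "\<eta> \<in> mult_chars \<Longrightarrow> \<eta> (- 1) * \<eta> (- 1) = 1"
  using mult_char_mult[of \<eta> "-1" "-1"] by simp

lemma inverse_mult_char_neg_one: "\<eta> \<in> mult_chars \<Longrightarrow> inverse (\<eta> (- 1)) = \<eta> (- 1)"
  by (rule inverse_unique) (rule mult_char_neg_one_square)

lemma char_inv_char_inv: "char_inv (char_inv \<eta>) = \<eta>"
  by (simp add: fun_eq_iff char_inv_def)

lemma char_inv_eq_triv_iff:
  assumes "\<alpha> \<in> mult_chars"
  shows "char_inv \<alpha> = triv_char \<longleftrightarrow> \<alpha> = triv_char"
  using assms by (auto simp: fun_eq_iff char_inv_def triv_char_def)

lemma sum_mult_char_eq_0: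
  assumes "\<eta> \<in> mult_chars" and "\<eta> \<noteq> triv_char"
  shows "(\<Sum>x\<in>UNIV. \<eta> x) = 0"
proof -
  obtain z where z: "\<eta> z \<noteq> triv_char z"
    using assms(2) by blast
  hence "z \<noteq> 0" "\<eta> z \<noteq> 1"
    using assms(1) by (auto simp: triv_char_def split: if_splits)
  have "(\<Sum>x\<in>UNIV. \<eta> x) = (\<Sum>x\<in>UNIV. \<eta> (z * x))"
    by (rule sum.reindex_bij_witness[of _ "\<lambda>x. z * x" "\<lambda>x. x / z"]) (use \<open>z \<noteq> 0\<close> in auto)
  also have "\<dots> = \<eta> z * (\<Sum>x\<in>UNIV. \<eta> x)"
    using assms(1) by (simp add: sum_distrib_left)
  finally show ?thesis
    using \<open>\<eta> z \<noteq> 1\<close> by (simp add: mult_cancel_right1)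
qed

lemma sum_triv_char: "(\<Sum>x\<in>UNIV. triv_char (x :: 'k::{finite,field})) = of_nat CARD('k) - 1"
proof -
  have "(\<Sum>x\<in>UNIV. triv_char (x :: 'k)) = (\<Sum>x\<in>UNIV - {0 :: 'k}. 1)"
    by (rule sum.mono_neutral_cong_right) (auto simp: triv_char_def)
  thus ?thesis
    using card_field_ge_2[where 'k = 'k] by (simp add: card_nonzero of_nat_diff)
qed

text \<open>
  All values lie in the finite set consisting of \<open>0\<close> and the \<open>(q - 1)\<close>-th roots of unity.
\<close>

lemma finite_mult_chars: "finite (mult_chars :: ('k::{finite,field} \<Rightarrow> qbar) set)"
proof -
  define n where "n = CARD('k) - 1"
  have n: "n > 0"
    using card_field_ge_2[where 'k = 'k] by (simp add: n_def)
  define Z where "Z = insert 0 {z :: qbar. z ^ n = 1}"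
  have "finite Z"
    using card_roots_of_power_le(1)[OF n] by (simp add: Z_def)
  hence "finite (PiE (UNIV :: 'k set) (\<lambda>_. Z))"
    by (simp add: finite_PiE)
  moreover have "mult_chars \<subseteq> PiE (UNIV :: 'k set) (\<lambda>_. Z)"
  proof
    fix \<eta> :: "'k \<Rightarrow> qbar" assume \<eta>: "\<eta> \<in> mult_chars"
    have "\<eta> x \<in> Z" for x
    proof (cases "x = 0")
      case False
      have "\<eta> x ^ n = \<eta> (x ^ n)"
        using \<eta> by simp
      also have "\<dots> = 1"
        unfolding n_def power_card_minus_1[OF False] using \<eta> by simp
      finally have "\<eta> x ^ n = 1" .
      thus ?thesis
        unfolding Z_def by blast
    qed (use \<eta> in \<open>simp add: Z_def\<close>)
    thus "\<eta> \<in> PiE UNIV (\<lambda>_. Z)"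
      by auto
  qed
  ultimately show ?thesis
    by (rule finite_subset[rotated])
qed

text \<open>
  Sending a generator of the cyclic group of units to an arbitrary \<open>(q - 1)\<close>-th root of unity \<open>\<zeta>\<close> defines a
  character. If \<open>x\<close> is the \<open>k\<close>-th power of the generator and \<open>r = k mod (q - 1)\<close> is not \<open>0\<close>, then
  the \<open>q - 1\<close> choices of \<open>\<zeta>\<close> cannot all be roots of the polynomial \<open>z\<^sup>r - 1\<close> of degree less than \<open>q - 1\<close>.
\<close>

lemma exists_mult_char_separating:
  fixes x :: "'k::{finite,field}"
  assumes "x \<noteq> 0" and "x \<noteq> 1"
  shows "\<exists>\<eta>\<in>mult_chars. \<eta> x \<noteq> 1"
proof -
  define n where "n = CARD('k) - 1"
  have n: "n > 0"
    using card_field_ge_2[where 'k = 'k] by (simp add: n_def)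
  obtain g :: 'k where g: "g \<noteq> 0" "\<And>x. x \<noteq> 0 \<Longrightarrow> \<exists>i::nat. x = g ^ i"
    using finite_field_units_cyclic by blast
  have ord: "n dvd i" if "g ^ i = 1" for i
    using primitive_power_eq_1[OF g that] by (simp add: n_def)
  obtain k where k: "x = g ^ k"
    using g(2) assms(1) by blast
  have gn: "g ^ n = 1"
    using power_card_minus_1[OF g(1)] by (simp add: n_def)
  define r where "r = k mod n"
  have "x = (g ^ n) ^ (k div n) * g ^ r"
    unfolding k by (metis mult_div_mod_eq power_add power_mult r_def)
  hence r: "r > 0" "r < n"
    using assms(2) gn n by (auto simp: r_def intro!: Nat.gr0I)
  have "\<exists>\<zeta>::qbar. \<zeta> ^ n = 1 \<and> \<zeta> ^ r \<noteq> 1"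
  proof (rule ccontr)
    assume "\<not> ?thesis"
    hence "{\<zeta>::qbar. \<zeta> ^ n = 1} \<subseteq> {\<zeta>. \<zeta> ^ r = 1}"
      by auto
    hence "card {\<zeta>::qbar. \<zeta> ^ n = 1} \<le> card {\<zeta>::qbar. \<zeta> ^ r = 1}"
      using card_roots_of_power_le(1)[OF r(1)] by (rule card_mono[rotated])
    also have "\<dots> \<le> r"
      by (rule card_roots_of_power_le(2)[OF r(1)])
    finally show False
      using card_roots_of_power_eq[of n "1 :: qbar"] n r(2) by simp
  qed
  then obtain \<zeta> :: qbar where \<zeta>: "\<zeta> ^ n = 1" "\<zeta> ^ r \<noteq> 1"
    by blast
  have "\<zeta> \<noteq> 0"
    using \<zeta>(1) n by (auto simp: power_0_left)
  have eq: "\<zeta> ^ i = \<zeta> ^ j" if "g ^ i = g ^ j" for i j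
    using that
  proof (induction i j rule: linorder_wlog)
    case (le i j)
    have "g ^ i * g ^ (j - i) = g ^ i * 1"
      using le by (metis le_add_diff_inverse mult_1_right power_add)
    hence "g ^ (j - i) = 1"
      using g(1) by simp
    then obtain e where "j - i = n * e"
      using ord by blast
    hence "\<zeta> ^ (j - i) = 1"
      by (simp add: power_mult \<zeta>(1))
    moreover have "\<zeta> ^ j = \<zeta> ^ i * \<zeta> ^ (j - i)"
      using le by (metis le_add_diff_inverse power_add)
    ultimately show ?case
      by simp
  qed metis
  define dlog where "dlog y = (SOME i::nat. y = g ^ i)" for y
  have dlog: "g ^ dlog y = y" if "y \<noteq> 0" for y
    unfolding dlog_def using someI_ex[OF g(2)[OF that]] by simp
  define \<eta> where "\<eta> y = (if y = 0 then 0 else \<zeta> ^ dlog y)" for y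
  have \<eta>g: "\<eta> (g ^ i) = \<zeta> ^ i" for i
    unfolding \<eta>_def using g(1) by (auto intro!: eq dlog)
  have "\<eta> \<in> mult_chars"
  proof -
    have "\<eta> (y * z) = \<eta> y * \<eta> z" for y z
    proof (cases "y = 0 \<or> z = 0")
      case False
      then obtain i j where "y = g ^ i" "z = g ^ j"
        using g(2) by blast
      thus ?thesis
        by (metis \<eta>g power_add)
    qed (auto simp: \<eta>_def)
    moreover have "\<eta> 1 = 1"
      using \<eta>g[of 0] by simp
    ultimately show ?thesis
      unfolding mult_chars_def by (simp add: \<eta>_def del: mult_char_mult)
  qed
  moreover have "\<eta> x \<noteq> 1"
  proof -
    have "\<zeta> ^ k = (\<zeta> ^ n) ^ (k div n) * \<zeta> ^ r"
      by (metis mult_div_mod_eq power_add power_mult r_def)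
    thus ?thesis
      using \<zeta> by (simp add: k \<eta>g)
  qed
  ultimately show ?thesis
    by blast
qed

lemma sum_mult_chars_eq_0:
  fixes x :: "'k::{finite,field}"
  assumes "x \<noteq> 1"
  shows "(\<Sum>\<eta>\<in>mult_chars. \<eta> x) = 0"
proof (cases "x = 0")
  case False
  then obtain \<theta> where \<theta>: "\<theta> \<in> mult_chars" "\<theta> x \<noteq> 1"
    using exists_mult_char_separating assms by blast
  have [simp]: "char_inv \<theta> \<odot> (\<theta> \<odot> \<eta>) = \<eta>" "\<theta> \<odot> (char_inv \<theta> \<odot> \<eta>) = \<eta>"
    if "\<eta> \<in> mult_chars" for \<eta>
    using that \<theta>(1) by (auto simp: fun_eq_iff char_mult_def char_inv_def field_simps)
  have "(\<Sum>\<eta>\<in>mult_chars. \<eta> x) = (\<Sum>\<eta>\<in>mult_chars. (\<theta> \<odot> \<eta>) x)"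
    by (rule sum.reindex_bij_witness[of _ "\<lambda>\<eta>. \<theta> \<odot> \<eta>" "\<lambda>\<eta>. char_inv \<theta> \<odot> \<eta>"]) (use \<theta>(1) in auto)
  also have "\<dots> = \<theta> x * (\<Sum>\<eta>\<in>mult_chars. \<eta> x)"
    by (simp add: sum_distrib_left char_mult_def)
  finally show ?thesis
    using \<theta>(2) by (simp add: mult_cancel_right1)
qed simp

text \<open>
  Both orthogonality relations applied to the sum of \<open>\<eta>(x)\<close> over all characters \<open>\<eta>\<close> and all \<open>x\<close>.
\<close>

lemma of_nat_card_mult_chars:
  "of_nat (card (mult_chars :: ('k::{finite,field} \<Rightarrow> qbar) set)) = (of_nat CARD('k) - 1 :: qbar)"
proof -
  have "(\<Sum>\<eta>\<in>mult_chars. \<Sum>x\<in>(UNIV::'k set). \<eta> x) = (\<Sum>x\<in>(UNIV::'k set). triv_char x)"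
    using finite_mult_chars
    by (subst sum.mono_neutral_right[of _ "{triv_char}"]) (auto simp: sum_mult_char_eq_0)
  moreover have "(\<Sum>\<eta>\<in>mult_chars. \<Sum>x\<in>(UNIV::'k set). \<eta> x) = (\<Sum>\<eta>\<in>(mult_chars :: ('k \<Rightarrow> qbar) set). \<eta> 1)"
    by (subst sum.swap, subst sum.mono_neutral_right[of _ "{1}"]) (auto simp: sum_mult_chars_eq_0)
  ultimately show ?thesis
    by (simp add: sum_triv_char)
qed

lemma sum_mult_chars:
  fixes x :: "'k::{finite,field}"
  shows "(\<Sum>\<eta>\<in>mult_chars. \<eta> x) = (if x = 1 then of_nat CARD('k) - 1 else 0)"
  by (simp add: sum_mult_chars_eq_0 of_nat_card_mult_chars)

section \<open>Jacobi sums\<close>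

lemma jacobi_eq_sum:
  assumes "\<alpha> \<in> mult_chars" "\<beta> \<in> mult_chars"
  shows "jacobi \<alpha> \<beta> = - (\<Sum>x\<in>UNIV. \<alpha> x * \<beta> (1 - x))"
proof -
  have *: "y = 1 - x" if "x + y = 1" for x y :: 'a
    using that by (metis add_diff_cancel_left')
  have "(\<Sum>(x, y)\<in>{(x, y). x \<noteq> 0 \<and> y \<noteq> 0 \<and> x + y = 1}. \<alpha> x * \<beta> y) = (\<Sum>x\<in>UNIV - {0, 1}. \<alpha> x * \<beta> (1 - x))"
    by (rule sum.reindex_bij_witness[of _ "\<lambda>x. (x, 1 - x)" fst]) (auto dest!: *)
  also have "\<dots> = (\<Sum>x\<in>UNIV. \<alpha> x * \<beta> (1 - x))"
    using assms by (intro sum.mono_neutral_left) auto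
  finally show ?thesis
    by (simp add: jacobi_def)
qed

lemma jacobi_commute:
  assumes "\<alpha> \<in> mult_chars" "\<beta> \<in> mult_chars"
  shows "jacobi \<alpha> \<beta> = jacobi \<beta> \<alpha>"
proof -
  have "(\<Sum>x\<in>UNIV. \<alpha> x * \<beta> (1 - x)) = (\<Sum>x\<in>UNIV. \<beta> x * \<alpha> (1 - x))"
    by (rule sum.reindex_bij_witness[of _ "\<lambda>x. 1 - x" "\<lambda>x. 1 - x"]) auto
  thus ?thesis
    using assms by (simp add: jacobi_eq_sum)
qed

text \<open>
  The substitution \<open>x = t / (1 + t)\<close>.
\<close>

lemma jacobi_eq_sum_inverse:
  assumes "\<alpha> \<in> mult_chars" "\<beta> \<in> mult_chars"
  shows "jacobi \<alpha> \<beta> = - (\<Sum>t\<in>UNIV. \<alpha> t * inverse (\<alpha> (1 + t) * \<beta> (1 + t)))"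
proof -
  have "(\<Sum>x\<in>UNIV. \<alpha> x * \<beta> (1 - x)) = (\<Sum>x\<in>UNIV - {1}. \<alpha> x * \<beta> (1 - x))"
    using assms by (intro sum.mono_neutral_right) auto
  also have "\<dots> = (\<Sum>t\<in>UNIV - {-1}. \<alpha> t * inverse (\<alpha> (1 + t) * \<beta> (1 + t)))"
  proof (rule sum.reindex_bij_witness[of _ "\<lambda>t. t / (1 + t)" "\<lambda>x. x / (1 - x)"], goal_cases)
    case (5 x)
    hence x: "1 - x \<noteq> 0" by auto
    have "1 + x / (1 - x) = 1 / (1 - x)"
      using x by (simp add: field_simps)
    thus ?case
      using assms x by (simp add: field_simps)
  next
    case (1 x)
    thus ?case by (simp add: field_simps)
  next
    case (2 x)
    thus ?case by (simp add: divide_eq_minus_1_iff)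
  next
    case (3 t)
    hence "1 + t \<noteq> 0" by (metis DiffD2 add.commute add_eq_0_iff insertI1)
    moreover from this have "1 - t / (1 + t) = 1 / (1 + t)"
      by (simp add: field_simps)
    ultimately show ?case by simp
  next
    case (4 t)
    hence "1 + t \<noteq> 0" by (metis DiffD2 add.commute add_eq_0_iff insertI1)
    thus ?case by (simp add: field_simps)
  qed
  also have "\<dots> = (\<Sum>t\<in>UNIV. \<alpha> t * inverse (\<alpha> (1 + t) * \<beta> (1 + t)))"
    using assms by (intro sum.mono_neutral_left) auto
  finally show ?thesis
    using assms by (simp add: jacobi_eq_sum)
qed

text \<open>
  With \<open>t = -w\<close> the sum in \<open>jacobi_eq_sum_inverse\<close> is again a Jacobi sum.
\<close>

lemma jacobi_reflect:
  assumes "\<alpha> \<in> mult_chars" "\<beta> \<in> mult_chars"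
  shows "jacobi \<alpha> \<beta> = \<alpha> (-1) * jacobi \<alpha> (char_inv (\<alpha> \<odot> \<beta>))"
proof -
  have "(\<Sum>t\<in>UNIV. \<alpha> t * inverse (\<alpha> (1 + t) * \<beta> (1 + t))) =
        (\<Sum>w\<in>UNIV. \<alpha> (-1) * (\<alpha> w * char_inv (\<alpha> \<odot> \<beta>) (1 - w)))"
  proof (rule sum.reindex_bij_witness[of _ uminus uminus], goal_cases)
    case (5 t)
    have "\<alpha> t = \<alpha> (-1) * \<alpha> (- t)"
      using mult_char_mult[OF assms(1), of "-1" "-t"] by simp
    thus ?case
      by (simp add: char_inv_def char_mult_def)
  qed simp_all
  thus ?thesis
    using assms by (simp add: jacobi_eq_sum_inverse[of \<alpha> \<beta>] jacobi_eq_sum[of \<alpha> "char_inv _"] sum_distrib_left)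
qed

lemma jacobi_char_inv:
  assumes "\<alpha> \<in> mult_chars" "\<alpha> \<noteq> triv_char"
  shows "jacobi \<alpha> (char_inv \<alpha>) = \<alpha> (-1)"
proof -
  have "\<alpha> t * inverse (\<alpha> (1 + t) * char_inv \<alpha> (1 + t)) = \<alpha> t - (if t = -1 then \<alpha> t else 0)" for t
    using assms(1) by (auto simp: char_inv_def add_eq_0_iff)
  thus ?thesis
    using assms by (simp add: jacobi_eq_sum_inverse sum_subtractf sum_mult_char_eq_0)
qed

section \<open>Gauss sums\<close>

lemma gauss_eq_sum: "\<eta> \<in> mult_chars \<Longrightarrow> gauss \<psi> \<eta> = - (\<Sum>x\<in>UNIV. \<psi> x * \<eta> x)"
  unfolding gauss_def by (simp add: sum.mono_neutral_left[of UNIV "UNIV - {0}"])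

locale nontrivial_add_char =
  fixes \<psi> :: "'k::{finite,field} \<Rightarrow> qbar"
  assumes add_char: "\<psi> \<in> add_chars" and nontrivial: "\<exists>x. \<psi> x \<noteq> 1"
begin

lemma psi_0: "\<psi> 0 = 1" and psi_add: "\<psi> (x + y) = \<psi> x * \<psi> y"
  using add_char by (auto simp: add_chars_def)

lemma sum_psi: "(\<Sum>x\<in>UNIV. \<psi> (x * a)) = (if a = 0 then of_nat CARD('k) else 0)"
proof (cases "a = 0")
  case False
  obtain z where z: "\<psi> z \<noteq> 1"
    using nontrivial by blast
  have "(\<Sum>x\<in>UNIV. \<psi> x) = (\<Sum>x\<in>UNIV. \<psi> (z + x))"
    by (rule sum.reindex_bij_witness[of _ "\<lambda>x. z + x" "\<lambda>x. x - z"]) auto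
  also have "\<dots> = \<psi> z * (\<Sum>x\<in>UNIV. \<psi> x)"
    by (simp add: psi_add sum_distrib_left)
  finally have "(\<Sum>x\<in>UNIV. \<psi> x) = 0"
    using z by (simp add: mult_cancel_right1)
  moreover have "(\<Sum>x\<in>UNIV. \<psi> (x * a)) = (\<Sum>x\<in>UNIV. \<psi> x)"
    by (rule sum.reindex_bij_witness[of _ "\<lambda>x. x / a" "\<lambda>x. x * a"]) (use False in auto)
  ultimately show ?thesis
    using False by simp
qed (simp add: psi_0)

lemma gauss_triv: "gauss \<psi> triv_char = 1"
proof -
  have "(\<Sum>x\<in>UNIV - {0}. \<psi> x * triv_char x) = (\<Sum>x\<in>UNIV - {0}. \<psi> x)"
    by (rule sum.cong) (auto simp: triv_char_def)
  also have "\<dots> = (\<Sum>x\<in>UNIV. \<psi> (x * 1)) - \<psi> 0"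
    by (simp add: sum_diff1)
  also have "\<dots> = -1"
    unfolding sum_psi by (simp add: psi_0)
  finally show ?thesis
    by (simp add: gauss_def)
qed

text \<open>
  For \<open>a = 0\<close> both sides vanish by orthogonality. The trivial character is excluded there because its sum
  is \<open>q - 1\<close>.
\<close>

lemma sum_psi_mult_char:
  assumes "\<eta> \<in> mult_chars" and "\<eta> \<noteq> triv_char \<or> a \<noteq> 0"
  shows "(\<Sum>x\<in>UNIV. \<psi> (x * a) * \<eta> x) = - gauss \<psi> \<eta> * inverse (\<eta> a)"
proof (cases "a = 0")
  case True
  thus ?thesis
    using assms by (simp add: psi_0 sum_mult_char_eq_0)
next
  case False
  have "(\<Sum>x\<in>UNIV. \<psi> (x * a) * \<eta> x) = (\<Sum>x\<in>UNIV. \<psi> x * \<eta> x * inverse (\<eta> a))"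
    by (rule sum.reindex_bij_witness[of _ "\<lambda>x. x / a" "\<lambda>x. x * a"]) (use False assms in auto)
  thus ?thesis
    using assms(1) by (simp add: gauss_eq_sum sum_distrib_right)
qed

text \<open>
  The product of the two sums, over \<open>x\<close> and \<open>y\<close>, is rearranged along the lines \<open>x = ty\<close>.
\<close>

lemma gauss_mult_gauss:
  assumes "\<alpha> \<in> mult_chars" "\<beta> \<in> mult_chars"
  shows "gauss \<psi> \<alpha> * gauss \<psi> \<beta> =
    (\<Sum>t\<in>UNIV. \<alpha> t * (\<Sum>y\<in>UNIV. \<psi> (y * (1 + t)) * (\<alpha> \<odot> \<beta>) y))"
proof -
  have "gauss \<psi> \<alpha> * gauss \<psi> \<beta> = (\<Sum>y\<in>UNIV. \<Sum>x\<in>UNIV. \<psi> x * \<alpha> x * (\<psi> y * \<beta> y))"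
    using assms by (simp add: gauss_eq_sum sum_product) (rule sum.swap)
  also have "\<dots> = (\<Sum>y\<in>UNIV. \<Sum>t\<in>UNIV. \<alpha> t * (\<psi> (y * (1 + t)) * (\<alpha> \<odot> \<beta>) y))"
  proof (rule sum.cong, rule refl)
    fix y :: 'k
    show "(\<Sum>x\<in>UNIV. \<psi> x * \<alpha> x * (\<psi> y * \<beta> y)) =
      (\<Sum>t\<in>UNIV. \<alpha> t * (\<psi> (y * (1 + t)) * (\<alpha> \<odot> \<beta>) y))"
    proof (cases "y = 0")
      case False
      show ?thesis
      proof (rule sum.reindex_bij_witness[of _ "\<lambda>t. t * y" "\<lambda>x. x / y"], goal_cases)
        case (5 x)
        have "y * (1 + x / y) = x + y"
          using False by (simp add: field_simps)
        moreover have "\<alpha> (x / y) * \<alpha> y = \<alpha> x"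
          using False assms(1) by simp
        ultimately show ?case
          by (simp add: char_mult_def psi_add mult_ac)
      qed (use False in auto)
    qed (use assms in \<open>simp add: char_mult_def\<close>)
  qed
  also have "\<dots> = (\<Sum>t\<in>UNIV. \<alpha> t * (\<Sum>y\<in>UNIV. \<psi> (y * (1 + t)) * (\<alpha> \<odot> \<beta>) y))"
    by (subst sum.swap) (simp add: sum_distrib_left)
  finally show ?thesis .
qed

text \<open>
  The inner sum in \<open>gauss_mult_gauss\<close> is a Gauss sum at \<open>1 + t\<close>. If \<open>\<alpha>\<beta>\<close> is trivial, the exceptional value
  at \<open>t = -1\<close> contributes the additional factor \<open>q\<close> by which \<open>gauss0\<close> differs from \<open>gauss\<close>.
\<close>

lemma gauss_mult_gauss_eq_jacobi:
  assumes "\<alpha> \<in> mult_chars" "\<beta> \<in> mult_chars" and "\<not> (\<alpha> = triv_char \<and> \<beta> = triv_char)"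
  shows "gauss \<psi> \<alpha> * gauss \<psi> \<beta> = gauss0 \<psi> (\<alpha> \<odot> \<beta>) * jacobi \<alpha> \<beta>"
proof (cases "\<alpha> \<odot> \<beta> = triv_char")
  case False
  have "gauss \<psi> \<alpha> * gauss \<psi> \<beta> = (\<Sum>t\<in>UNIV. \<alpha> t * (- gauss \<psi> (\<alpha> \<odot> \<beta>) * inverse ((\<alpha> \<odot> \<beta>) (1 + t))))"
    using assms False by (simp add: gauss_mult_gauss sum_psi_mult_char)
  also have "\<dots> = - gauss \<psi> (\<alpha> \<odot> \<beta>) * (\<Sum>t\<in>UNIV. \<alpha> t * inverse (\<alpha> (1 + t) * \<beta> (1 + t)))"
    by (simp add: sum_distrib_left char_mult_def mult_ac)
  also have "\<dots> = gauss0 \<psi> (\<alpha> \<odot> \<beta>) * jacobi \<alpha> \<beta>"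
    using assms False by (simp add: jacobi_eq_sum_inverse gauss0_def)
  finally show ?thesis .
next
  case True
  have \<beta>: "\<beta> = char_inv \<alpha>"
  proof
    fix x
    show "\<beta> x = char_inv \<alpha> x"
      using fun_cong[OF True, of x] assms(1,2)
      by (cases "x = 0") (auto simp: char_mult_def triv_char_def char_inv_def intro!: inverse_unique[symmetric])
  qed
  have "\<alpha> \<noteq> triv_char"
    using assms(3) char_inv_eq_triv_iff[OF assms(1)] by (auto simp: \<beta>)
  have inner: "(\<Sum>y\<in>UNIV. \<psi> (y * (1 + t)) * triv_char y) = (if t = -1 then of_nat CARD('k) else 0) - 1" for t
  proof (cases "t = -1")
    case True
    thus ?thesis
      by (simp add: psi_0 sum_triv_char)
  next
    case False
    hence "1 + t \<noteq> 0"
      by (metis add_eq_0_iff)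
    thus ?thesis
      using False by (simp add: sum_psi_mult_char gauss_triv) (simp add: triv_char_def)
  qed
  have "gauss \<psi> \<alpha> * gauss \<psi> \<beta> = (\<Sum>t\<in>UNIV. \<alpha> t * ((if t = -1 then of_nat CARD('k) else 0) - 1))"
    using assms True by (simp add: gauss_mult_gauss inner)
  also have "\<dots> = (\<Sum>t\<in>UNIV. (if t = -1 then of_nat CARD('k) * \<alpha> t else 0) - \<alpha> t)"
    by (rule sum.cong) (auto simp: algebra_simps)
  also have "\<dots> = of_nat CARD('k) * \<alpha> (-1)"
    using assms(1) \<open>\<alpha> \<noteq> triv_char\<close> by (simp add: sum_subtractf sum_mult_char_eq_0)
  finally show ?thesis
    using assms(1) \<open>\<alpha> \<noteq> triv_char\<close> by (simp add: True gauss0_def gauss_triv) (simp add: \<beta> jacobi_char_inv)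
qed

lemma gauss_mult_gauss0_char_inv:
  assumes "\<eta> \<in> mult_chars"
  shows "gauss \<psi> \<eta> * gauss0 \<psi> (char_inv \<eta>) = \<eta> (-1) * of_nat CARD('k)"
proof (cases "\<eta> = triv_char")
  case True
  have "char_inv triv_char = (triv_char :: 'k \<Rightarrow> qbar)"
    by (simp add: char_inv_eq_triv_iff)
  thus ?thesis
    by (simp add: True gauss0_def gauss_triv triv_char_def)
next
  case False
  hence ne: "char_inv \<eta> \<noteq> triv_char"
    using assms by (simp add: char_inv_eq_triv_iff)
  have "\<eta> \<odot> char_inv \<eta> = triv_char"
    using assms by (auto simp: fun_eq_iff char_mult_def char_inv_def triv_char_def)
  hence "gauss \<psi> \<eta> * gauss \<psi> (char_inv \<eta>) = of_nat CARD('k) * \<eta> (-1)"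
    using gauss_mult_gauss_eq_jacobi[of \<eta> "char_inv \<eta>"] assms False
    by (simp add: jacobi_char_inv gauss0_def gauss_triv)
  thus ?thesis
    using ne by (simp add: gauss0_def)
qed

lemma gauss_neq_0:
  assumes "\<eta> \<in> mult_chars"
  shows "gauss \<psi> \<eta> \<noteq> 0"
  using gauss_mult_gauss0_char_inv[OF assms] assms by auto

text \<open>
  With \<open>gauss0\<close> in the denominator and \<open>gauss\<close> in the numerator, this holds for the trivial character as well.
  It moves the denominators of Appell's function into the numerator.
\<close>

lemma inverse_gauss0:
  assumes "\<eta> \<in> mult_chars"
  shows "inverse (gauss0 \<psi> \<eta>) = \<eta> (-1) * gauss \<psi> (char_inv \<eta>) / of_nat CARD('k)"
proof -
  have "gauss \<psi> (char_inv \<eta>) * gauss0 \<psi> \<eta> = \<eta> (-1) * of_nat CARD('k)"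
    using gauss_mult_gauss0_char_inv[of "char_inv \<eta>"] assms
    by (simp add: char_inv_char_inv char_inv_def inverse_mult_char_neg_one)
  hence "\<eta> (-1) * gauss \<psi> (char_inv \<eta>) * gauss0 \<psi> \<eta> = \<eta> (-1) * \<eta> (-1) * of_nat CARD('k)"
    by (simp add: mult_ac)
  hence "gauss0 \<psi> \<eta> * (\<eta> (-1) * gauss \<psi> (char_inv \<eta>) / of_nat CARD('k)) = 1"
    using assms by (simp add: mult_char_neg_one_square field_simps)
  thus ?thesis
    by (rule inverse_unique)
qed

end

section \<open>Appell's function as a double sum\<close>

text \<open>
  The summand of the double sum to which Appell's function reduces. The conventions \<open>inverse 0 = 0\<close> and
  \<open>\<eta>(0) = 0\<close> make it vanish at \<open>u = 0\<close>, at \<open>v = 0\<close> and at the zeros of \<open>1 + u + w\<^sub>2 / v\<close> and \<open>1 + v + w\<^sub>1 / u\<close>, so that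
  sums of it may run over the whole field.
\<close>

definition F4_kernel ::
  "('k::{finite,field} \<Rightarrow> qbar) \<Rightarrow> ('k \<Rightarrow> qbar) \<Rightarrow> ('k \<Rightarrow> qbar) \<Rightarrow> ('k \<Rightarrow> qbar) \<Rightarrow> 'k \<Rightarrow> 'k \<Rightarrow> 'k \<Rightarrow> 'k \<Rightarrow> qbar" where
  "F4_kernel \<alpha> \<beta> \<gamma>\<^sub>1 \<gamma>\<^sub>2 w\<^sub>1 w\<^sub>2 u v =
     inverse (\<gamma>\<^sub>1 u) * inverse (\<gamma>\<^sub>2 v)
     * inverse ((\<alpha> \<odot> char_inv \<gamma>\<^sub>1) (1 + u + w\<^sub>2 / v)) * inverse ((\<beta> \<odot> char_inv \<gamma>\<^sub>2) (1 + v + w\<^sub>1 / u))"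

lemma sum_swap_pairs:
  fixes f :: "'a \<Rightarrow> 'b \<Rightarrow> 'c \<Rightarrow> 'd \<Rightarrow> 'e::comm_monoid_add"
  shows "(\<Sum>a\<in>A. \<Sum>b\<in>B. \<Sum>c\<in>C. \<Sum>d\<in>D. f a b c d) = (\<Sum>c\<in>C. \<Sum>d\<in>D. \<Sum>a\<in>A. \<Sum>b\<in>B. f a b c d)"
proof -
  have swap3: "(\<Sum>a\<in>A. \<Sum>b\<in>B. \<Sum>e\<in>E. g a b e) = (\<Sum>e\<in>E. \<Sum>a\<in>A. \<Sum>b\<in>B. g a b e)"
    for g :: "'a \<Rightarrow> 'b \<Rightarrow> 'x \<Rightarrow> 'e" and E
  proof -
    have "(\<Sum>a\<in>A. \<Sum>b\<in>B. \<Sum>e\<in>E. g a b e) = (\<Sum>a\<in>A. \<Sum>e\<in>E. \<Sum>b\<in>B. g a b e)"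
      by (intro sum.cong refl sum.swap)
    also have "\<dots> = (\<Sum>e\<in>E. \<Sum>a\<in>A. \<Sum>b\<in>B. g a b e)"
      by (rule sum.swap)
    finally show ?thesis .
  qed
  show ?thesis
    unfolding swap3[of _ C] by (intro sum.cong refl swap3)
qed

context nontrivial_add_char
begin

text \<open>
  Mellin inversion: in the expanded product the sum over \<open>\<nu>\<close> is a sum of values \<open>\<nu>(z / (uv))\<close>, which singles out \<open>v = z / u\<close>.
\<close>

lemma sum_gauss_gauss_eq_kloosterman:
  assumes "\<gamma> \<in> mult_chars" and "z \<noteq> 0"
  shows "(\<Sum>\<nu>\<in>mult_chars. gauss \<psi> (char_inv (\<gamma> \<odot> \<nu>)) * gauss \<psi> (char_inv \<nu>) * \<nu> z) =
    (of_nat CARD('k) - 1) * (\<Sum>u\<in>UNIV. inverse (\<gamma> u) * \<psi> (u + z / u))"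
proof -
  have "(\<Sum>\<nu>\<in>mult_chars. gauss \<psi> (char_inv (\<gamma> \<odot> \<nu>)) * gauss \<psi> (char_inv \<nu>) * \<nu> z) =
    (\<Sum>\<nu>\<in>mult_chars. \<Sum>u\<in>UNIV. \<Sum>v\<in>UNIV. inverse (\<gamma> u) * \<psi> (u + v) * \<nu> (z / (u * v)))"
  proof (rule sum.cong, rule refl)
    fix \<nu> :: "'k \<Rightarrow> qbar" assume \<nu>: "\<nu> \<in> mult_chars"
    show "gauss \<psi> (char_inv (\<gamma> \<odot> \<nu>)) * gauss \<psi> (char_inv \<nu>) * \<nu> z =
      (\<Sum>u\<in>UNIV. \<Sum>v\<in>UNIV. inverse (\<gamma> u) * \<psi> (u + v) * \<nu> (z / (u * v)))"
      unfolding gauss_eq_sum[OF char_inv_mem[OF \<nu>]] gauss_eq_sum[OF char_inv_mem[OF char_mult_mem[OF assms(1) \<nu>]]]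
        minus_mult_minus sum_product unfolding sum_distrib_right
      using \<nu> by (intro sum.cong refl) (simp_all add: char_inv_def char_mult_def psi_add divide_inverse mult_ac)
  qed
  also have "\<dots> = (\<Sum>u\<in>UNIV. \<Sum>\<nu>\<in>mult_chars. \<Sum>v\<in>UNIV. inverse (\<gamma> u) * \<psi> (u + v) * \<nu> (z / (u * v)))"
    by (rule sum.swap)
  also have "\<dots> = (\<Sum>u\<in>UNIV. \<Sum>v\<in>UNIV. inverse (\<gamma> u) * \<psi> (u + v) * (\<Sum>\<nu>\<in>mult_chars. \<nu> (z / (u * v))))"
    by (subst sum.swap) (simp only: sum_distrib_left)
  also have "\<dots> = (\<Sum>u\<in>UNIV. (of_nat CARD('k) - 1) * (inverse (\<gamma> u) * \<psi> (u + z / u)))"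
  proof (rule sum.cong, rule refl)
    fix u :: 'k
    show "(\<Sum>v\<in>UNIV. inverse (\<gamma> u) * \<psi> (u + v) * (\<Sum>\<nu>\<in>mult_chars. \<nu> (z / (u * v)))) =
      (of_nat CARD('k) - 1) * (inverse (\<gamma> u) * \<psi> (u + z / u))"
    proof (cases "u = 0")
      case False
      have iff: "z / (u * v) = 1 \<longleftrightarrow> v = z / u" for v
        using False assms(2) by (auto simp: field_simps)
      show ?thesis
        unfolding sum_mult_chars iff by (simp add: if_distrib mult_ac cong: if_cong)
    qed (use assms in simp)
  qed
  finally show ?thesis
    by (simp only: sum_distrib_left)
qed

lemma kloosterman_scale:
  assumes "\<gamma> \<in> mult_chars" and "s \<noteq> 0"
  shows "(\<Sum>u\<in>UNIV. inverse (\<gamma> u) * \<psi> (u + s * z / u)) =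
    inverse (\<gamma> s) * (\<Sum>u\<in>UNIV. inverse (\<gamma> u) * \<psi> (s * u + z / u))"
proof -
  have "(\<Sum>u\<in>UNIV. inverse (\<gamma> u) * \<psi> (u + s * z / u)) =
    (\<Sum>u\<in>UNIV. inverse (\<gamma> s) * (inverse (\<gamma> u) * \<psi> (s * u + z / u)))"
  proof (rule sum.reindex_bij_witness[of _ "\<lambda>u. s * u" "\<lambda>u. u / s"], goal_cases)
    case (5 u)
    have "inverse (\<gamma> s) * inverse (\<gamma> (u / s)) = inverse (\<gamma> u)"
      using assms by (simp add: inverse_eq_divide)
    moreover have "s * (u / s) + z / (u / s) = u + s * z / u"
      using assms by (simp add: mult.commute)
    ultimately show ?case
      by (metis mult.assoc)
  qed (use assms in auto)
  thus ?thesis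
    by (simp only: sum_distrib_left)
qed

text \<open>
  The two Gauss sums that contain \<open>\<nu>\<^sub>1\<nu>\<^sub>2\<close> are expanded in variables \<open>s\<close> and \<open>t\<close>. The remaining factors are Kloosterman
  sums at \<open>stw\<^sub>1\<close> and \<open>stw\<^sub>2\<close>. It matters that the first is rescaled by \<open>s\<close> and the second by \<open>t\<close>:
  the characters of \<open>s\<close> and \<open>t\<close> that arise are then \<open>\<alpha>/\<gamma>\<^sub>1\<close> and \<open>\<beta>/\<gamma>\<^sub>2\<close>, which are non-trivial by assumption.
  Rescaling both by \<open>s\<close> would give \<open>\<alpha>/(\<gamma>\<^sub>1\<gamma>\<^sub>2)\<close> and \<open>\<beta>\<close> instead.
\<close>

lemma sum_gauss_eq_double_sum:
  assumes "\<alpha> \<in> mult_chars" "\<beta> \<in> mult_chars" "\<gamma>\<^sub>1 \<in> mult_chars" "\<gamma>\<^sub>2 \<in> mult_chars"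
    and "\<alpha> \<odot> char_inv \<gamma>\<^sub>1 \<noteq> triv_char" "\<beta> \<odot> char_inv \<gamma>\<^sub>2 \<noteq> triv_char"
    and "w\<^sub>1 \<noteq> 0" "w\<^sub>2 \<noteq> 0"
  shows "(\<Sum>\<nu>\<^sub>1\<in>mult_chars. \<Sum>\<nu>\<^sub>2\<in>mult_chars.
      gauss \<psi> (\<alpha> \<odot> (\<nu>\<^sub>1 \<odot> \<nu>\<^sub>2)) * gauss \<psi> (\<beta> \<odot> (\<nu>\<^sub>1 \<odot> \<nu>\<^sub>2))
      * (gauss \<psi> (char_inv (\<gamma>\<^sub>1 \<odot> \<nu>\<^sub>1)) * gauss \<psi> (char_inv \<nu>\<^sub>1) * \<nu>\<^sub>1 w\<^sub>1)
      * (gauss \<psi> (char_inv (\<gamma>\<^sub>2 \<odot> \<nu>\<^sub>2)) * gauss \<psi> (char_inv \<nu>\<^sub>2) * \<nu>\<^sub>2 w\<^sub>2)) =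
    (of_nat CARD('k) - 1)\<^sup>2 * gauss \<psi> (\<alpha> \<odot> char_inv \<gamma>\<^sub>1) * gauss \<psi> (\<beta> \<odot> char_inv \<gamma>\<^sub>2) *
    (\<Sum>u\<in>UNIV. \<Sum>v\<in>UNIV. F4_kernel \<alpha> \<beta> \<gamma>\<^sub>1 \<gamma>\<^sub>2 w\<^sub>1 w\<^sub>2 u v)"
proof -
  define G where "G \<gamma> \<nu> = gauss \<psi> (char_inv (\<gamma> \<odot> \<nu>)) * gauss \<psi> (char_inv \<nu>)" for \<gamma> \<nu>
  define q where "q = (of_nat CARD('k) :: qbar)"
  have G: "(\<Sum>\<nu>\<in>mult_chars. G \<gamma> \<nu> * \<nu> (s * z)) =
      (q - 1) * (inverse (\<gamma> s) * (\<Sum>u\<in>UNIV. inverse (\<gamma> u) * \<psi> (s * u + z / u)))"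
    if "\<gamma> \<in> mult_chars" "s \<noteq> 0" "z \<noteq> 0" for \<gamma> s z
    using that unfolding G_def q_def by (subst sum_gauss_gauss_eq_kloosterman) (simp_all add: kloosterman_scale)
  have "(\<Sum>\<nu>\<^sub>1\<in>mult_chars. \<Sum>\<nu>\<^sub>2\<in>mult_chars.
      gauss \<psi> (\<alpha> \<odot> (\<nu>\<^sub>1 \<odot> \<nu>\<^sub>2)) * gauss \<psi> (\<beta> \<odot> (\<nu>\<^sub>1 \<odot> \<nu>\<^sub>2)) * (G \<gamma>\<^sub>1 \<nu>\<^sub>1 * \<nu>\<^sub>1 w\<^sub>1) * (G \<gamma>\<^sub>2 \<nu>\<^sub>2 * \<nu>\<^sub>2 w\<^sub>2)) =
    (\<Sum>\<nu>\<^sub>1\<in>mult_chars. \<Sum>\<nu>\<^sub>2\<in>mult_chars. \<Sum>s\<in>UNIV. \<Sum>t\<in>UNIV.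
      (\<psi> (s + t) * \<alpha> s * \<beta> t) * ((G \<gamma>\<^sub>1 \<nu>\<^sub>1 * \<nu>\<^sub>1 (s * (t * w\<^sub>1))) * (G \<gamma>\<^sub>2 \<nu>\<^sub>2 * \<nu>\<^sub>2 (t * (s * w\<^sub>2)))))"
  proof (intro sum.cong refl)
    fix \<nu>\<^sub>1 \<nu>\<^sub>2 :: "'k \<Rightarrow> qbar" assume \<nu>: "\<nu>\<^sub>1 \<in> mult_chars" "\<nu>\<^sub>2 \<in> mult_chars"
    show "gauss \<psi> (\<alpha> \<odot> (\<nu>\<^sub>1 \<odot> \<nu>\<^sub>2)) * gauss \<psi> (\<beta> \<odot> (\<nu>\<^sub>1 \<odot> \<nu>\<^sub>2)) * (G \<gamma>\<^sub>1 \<nu>\<^sub>1 * \<nu>\<^sub>1 w\<^sub>1) * (G \<gamma>\<^sub>2 \<nu>\<^sub>2 * \<nu>\<^sub>2 w\<^sub>2) =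
      (\<Sum>s\<in>UNIV. \<Sum>t\<in>UNIV.
        (\<psi> (s + t) * \<alpha> s * \<beta> t) * ((G \<gamma>\<^sub>1 \<nu>\<^sub>1 * \<nu>\<^sub>1 (s * (t * w\<^sub>1))) * (G \<gamma>\<^sub>2 \<nu>\<^sub>2 * \<nu>\<^sub>2 (t * (s * w\<^sub>2)))))"
      unfolding gauss_eq_sum[OF char_mult_mem[OF assms(1) char_mult_mem[OF \<nu>]]]
        gauss_eq_sum[OF char_mult_mem[OF assms(2) char_mult_mem[OF \<nu>]]]
        minus_mult_minus sum_product unfolding sum_distrib_right
      using \<nu> by (intro sum.cong refl) (simp_all add: char_mult_def psi_add mult_ac)
  qed
  also have "\<dots> = (\<Sum>s\<in>UNIV. \<Sum>t\<in>UNIV. (\<psi> (s + t) * \<alpha> s * \<beta> t) *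
      ((\<Sum>\<nu>\<^sub>1\<in>mult_chars. G \<gamma>\<^sub>1 \<nu>\<^sub>1 * \<nu>\<^sub>1 (s * (t * w\<^sub>1))) * (\<Sum>\<nu>\<^sub>2\<in>mult_chars. G \<gamma>\<^sub>2 \<nu>\<^sub>2 * \<nu>\<^sub>2 (t * (s * w\<^sub>2)))))"
    unfolding sum_swap_pairs[of _ UNIV UNIV] sum_product by (simp only: sum_distrib_left)
  also have "\<dots> = (\<Sum>s\<in>UNIV. \<Sum>t\<in>UNIV. (\<psi> (s + t) * \<alpha> s * \<beta> t) *
      (((q - 1) * (inverse (\<gamma>\<^sub>1 s) * (\<Sum>u\<in>UNIV. inverse (\<gamma>\<^sub>1 u) * \<psi> (s * u + t * w\<^sub>1 / u)))) *
      ((q - 1) * (inverse (\<gamma>\<^sub>2 t) * (\<Sum>v\<in>UNIV. inverse (\<gamma>\<^sub>2 v) * \<psi> (t * v + s * w\<^sub>2 / v))))))"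
  proof (intro sum.cong refl)
    fix s t :: 'k
    show "(\<psi> (s + t) * \<alpha> s * \<beta> t) *
      ((\<Sum>\<nu>\<^sub>1\<in>mult_chars. G \<gamma>\<^sub>1 \<nu>\<^sub>1 * \<nu>\<^sub>1 (s * (t * w\<^sub>1))) * (\<Sum>\<nu>\<^sub>2\<in>mult_chars. G \<gamma>\<^sub>2 \<nu>\<^sub>2 * \<nu>\<^sub>2 (t * (s * w\<^sub>2)))) =
      (\<psi> (s + t) * \<alpha> s * \<beta> t) *
      (((q - 1) * (inverse (\<gamma>\<^sub>1 s) * (\<Sum>u\<in>UNIV. inverse (\<gamma>\<^sub>1 u) * \<psi> (s * u + t * w\<^sub>1 / u)))) *
      ((q - 1) * (inverse (\<gamma>\<^sub>2 t) * (\<Sum>v\<in>UNIV. inverse (\<gamma>\<^sub>2 v) * \<psi> (t * v + s * w\<^sub>2 / v)))))"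
    proof (cases "s = 0 \<or> t = 0")
      case True
      hence "\<psi> (s + t) * \<alpha> s * \<beta> t = 0"
        using assms(1,2) by auto
      thus ?thesis
        by (simp only: mult_zero_left)
    next
      case False
      hence nz: "s \<noteq> 0" "t \<noteq> 0" "t * w\<^sub>1 \<noteq> 0" "s * w\<^sub>2 \<noteq> 0"
        using assms(7,8) by auto
      show ?thesis
        unfolding G[OF assms(3) nz(1,3)] G[OF assms(4) nz(2,4)] by (rule refl)
    qed
  qed
  also have "\<dots> = (q - 1)\<^sup>2 * (\<Sum>s\<in>UNIV. \<Sum>t\<in>UNIV. \<Sum>u\<in>UNIV. \<Sum>v\<in>UNIV.
      inverse (\<gamma>\<^sub>1 u) * inverse (\<gamma>\<^sub>2 v) * ((\<psi> (s * (1 + u + w\<^sub>2 / v)) * (\<alpha> \<odot> char_inv \<gamma>\<^sub>1) s)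
        * (\<psi> (t * (1 + v + w\<^sub>1 / u)) * (\<beta> \<odot> char_inv \<gamma>\<^sub>2) t)))"
    unfolding sum_distrib_left[of "(q - 1)\<^sup>2"]
  proof (rule sum.cong[OF refl], rule sum.cong[OF refl])
    fix s t :: 'k
    have summand: "(\<psi> (s + t) * \<alpha> s * \<beta> t) * ((q - 1)\<^sup>2 * (inverse (\<gamma>\<^sub>1 s) * inverse (\<gamma>\<^sub>2 t))) * ((inverse (\<gamma>\<^sub>1 u) * \<psi> (s * u + t * w\<^sub>1 / u)) * (inverse (\<gamma>\<^sub>2 v) * \<psi> (t * v + s * w\<^sub>2 / v))) =
      (q - 1)\<^sup>2 * (inverse (\<gamma>\<^sub>1 u) * inverse (\<gamma>\<^sub>2 v) * ((\<psi> (s * (1 + u + w\<^sub>2 / v)) * (\<alpha> \<odot> char_inv \<gamma>\<^sub>1) s) * (\<psi> (t * (1 + v + w\<^sub>1 / u)) * (\<beta> \<odot> char_inv \<gamma>\<^sub>2) t)))" for u v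
    proof -
      have psi: "\<psi> (s + t) * \<psi> (s * u + t * w\<^sub>1 / u) * \<psi> (t * v + s * w\<^sub>2 / v) =
        \<psi> (s * (1 + u + w\<^sub>2 / v)) * \<psi> (t * (1 + v + w\<^sub>1 / u))"
        unfolding psi_add[symmetric] by (rule arg_cong[of _ _ \<psi>]) (simp add: algebra_simps)
      have "(\<psi> (s + t) * \<alpha> s * \<beta> t) * ((q - 1)\<^sup>2 * (inverse (\<gamma>\<^sub>1 s) * inverse (\<gamma>\<^sub>2 t))) * ((inverse (\<gamma>\<^sub>1 u) * \<psi> (s * u + t * w\<^sub>1 / u)) * (inverse (\<gamma>\<^sub>2 v) * \<psi> (t * v + s * w\<^sub>2 / v))) =
        (\<psi> (s + t) * \<psi> (s * u + t * w\<^sub>1 / u) * \<psi> (t * v + s * w\<^sub>2 / v)) *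
        ((q - 1)\<^sup>2 * (inverse (\<gamma>\<^sub>1 u) * inverse (\<gamma>\<^sub>2 v) * (\<alpha> s * inverse (\<gamma>\<^sub>1 s)) * (\<beta> t * inverse (\<gamma>\<^sub>2 t))))"
        by (simp only: mult_ac)
      also have "\<dots> = (q - 1)\<^sup>2 * (inverse (\<gamma>\<^sub>1 u) * inverse (\<gamma>\<^sub>2 v) * ((\<psi> (s * (1 + u + w\<^sub>2 / v)) * (\<alpha> \<odot> char_inv \<gamma>\<^sub>1) s) * (\<psi> (t * (1 + v + w\<^sub>1 / u)) * (\<beta> \<odot> char_inv \<gamma>\<^sub>2) t)))"
        unfolding psi char_mult_def char_inv_def by (simp only: mult_ac)
      finally show ?thesis .
    qed
    have "(\<psi> (s + t) * \<alpha> s * \<beta> t) * (((q - 1) * (inverse (\<gamma>\<^sub>1 s) * (\<Sum>u\<in>UNIV. inverse (\<gamma>\<^sub>1 u) * \<psi> (s * u + t * w\<^sub>1 / u)))) * ((q - 1) * (inverse (\<gamma>\<^sub>2 t) * (\<Sum>v\<in>UNIV. inverse (\<gamma>\<^sub>2 v) * \<psi> (t * v + s * w\<^sub>2 / v))))) =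
      (\<psi> (s + t) * \<alpha> s * \<beta> t) * ((q - 1)\<^sup>2 * (inverse (\<gamma>\<^sub>1 s) * inverse (\<gamma>\<^sub>2 t))) * ((\<Sum>u\<in>UNIV. inverse (\<gamma>\<^sub>1 u) * \<psi> (s * u + t * w\<^sub>1 / u)) * (\<Sum>v\<in>UNIV. inverse (\<gamma>\<^sub>2 v) * \<psi> (t * v + s * w\<^sub>2 / v)))"
      by (simp only: power2_eq_square mult_ac)
    also have "\<dots> = (\<Sum>u\<in>UNIV. \<Sum>v\<in>UNIV. (q - 1)\<^sup>2 * (inverse (\<gamma>\<^sub>1 u) * inverse (\<gamma>\<^sub>2 v) * ((\<psi> (s * (1 + u + w\<^sub>2 / v)) * (\<alpha> \<odot> char_inv \<gamma>\<^sub>1) s) * (\<psi> (t * (1 + v + w\<^sub>1 / u)) * (\<beta> \<odot> char_inv \<gamma>\<^sub>2) t))))"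
      unfolding sum_product unfolding sum_distrib_left summand by (rule refl)
    finally show "(\<psi> (s + t) * \<alpha> s * \<beta> t) * (((q - 1) * (inverse (\<gamma>\<^sub>1 s) * (\<Sum>u\<in>UNIV. inverse (\<gamma>\<^sub>1 u) * \<psi> (s * u + t * w\<^sub>1 / u)))) * ((q - 1) * (inverse (\<gamma>\<^sub>2 t) * (\<Sum>v\<in>UNIV. inverse (\<gamma>\<^sub>2 v) * \<psi> (t * v + s * w\<^sub>2 / v))))) =
      (\<Sum>u\<in>UNIV. \<Sum>v\<in>UNIV. (q - 1)\<^sup>2 * (inverse (\<gamma>\<^sub>1 u) * inverse (\<gamma>\<^sub>2 v) * ((\<psi> (s * (1 + u + w\<^sub>2 / v)) * (\<alpha> \<odot> char_inv \<gamma>\<^sub>1) s) * (\<psi> (t * (1 + v + w\<^sub>1 / u)) * (\<beta> \<odot> char_inv \<gamma>\<^sub>2) t))))" .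
  qed
  also have "\<dots> = (q - 1)\<^sup>2 * (\<Sum>u\<in>UNIV. \<Sum>v\<in>UNIV. inverse (\<gamma>\<^sub>1 u) * inverse (\<gamma>\<^sub>2 v)
      * ((\<Sum>s\<in>UNIV. \<psi> (s * (1 + u + w\<^sub>2 / v)) * (\<alpha> \<odot> char_inv \<gamma>\<^sub>1) s)
        * (\<Sum>t\<in>UNIV. \<psi> (t * (1 + v + w\<^sub>1 / u)) * (\<beta> \<odot> char_inv \<gamma>\<^sub>2) t)))"
    unfolding sum_product by (subst sum_swap_pairs) (simp only: sum_distrib_left)
  also have "\<dots> = (q - 1)\<^sup>2 * gauss \<psi> (\<alpha> \<odot> char_inv \<gamma>\<^sub>1) * gauss \<psi> (\<beta> \<odot> char_inv \<gamma>\<^sub>2) *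
    (\<Sum>u\<in>UNIV. \<Sum>v\<in>UNIV. F4_kernel \<alpha> \<beta> \<gamma>\<^sub>1 \<gamma>\<^sub>2 w\<^sub>1 w\<^sub>2 u v)"
    unfolding F4_kernel_def sum_psi_mult_char[OF char_mult_mem[OF assms(1) char_inv_mem[OF assms(3)]] disjI1[OF assms(5)]]
      sum_psi_mult_char[OF char_mult_mem[OF assms(2) char_inv_mem[OF assms(4)]] disjI1[OF assms(6)]]
    by (simp add: sum_distrib_left mult_ac)
  finally show ?thesis
    unfolding G_def q_def by (simp only: mult.assoc)
qed

text \<open>
  The signs that \<open>inverse_gauss0\<close> produces for \<open>\<gamma>\<nu>\<close> and for \<open>\<nu>\<close> multiply to \<open>\<gamma>(-1)\<close>.
\<close>

lemma appell_F4_eq_sum_gauss: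
  assumes "\<alpha> \<in> mult_chars" "\<beta> \<in> mult_chars" "\<gamma>\<^sub>1 \<in> mult_chars" "\<gamma>\<^sub>2 \<in> mult_chars"
  shows "appell_F4 \<psi> \<alpha> \<beta> \<gamma>\<^sub>1 \<gamma>\<^sub>2 w\<^sub>1 w\<^sub>2 = 1 / (1 - of_nat CARD('k))\<^sup>2 *
    (gauss0 \<psi> \<gamma>\<^sub>1 * gauss0 \<psi> \<gamma>\<^sub>2 * \<gamma>\<^sub>1 (-1) * \<gamma>\<^sub>2 (-1) / (gauss \<psi> \<alpha> * gauss \<psi> \<beta> * (of_nat CARD('k))\<^sup>2)) *
    (\<Sum>\<nu>\<^sub>1\<in>mult_chars. \<Sum>\<nu>\<^sub>2\<in>mult_chars.
      gauss \<psi> (\<alpha> \<odot> (\<nu>\<^sub>1 \<odot> \<nu>\<^sub>2)) * gauss \<psi> (\<beta> \<odot> (\<nu>\<^sub>1 \<odot> \<nu>\<^sub>2))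
      * (gauss \<psi> (char_inv (\<gamma>\<^sub>1 \<odot> \<nu>\<^sub>1)) * gauss \<psi> (char_inv \<nu>\<^sub>1) * \<nu>\<^sub>1 w\<^sub>1)
      * (gauss \<psi> (char_inv (\<gamma>\<^sub>2 \<odot> \<nu>\<^sub>2)) * gauss \<psi> (char_inv \<nu>\<^sub>2) * \<nu>\<^sub>2 w\<^sub>2))"
proof -
  define q where "q = (of_nat CARD('k) :: qbar)"
  have "q \<noteq> 0"
    by (simp add: q_def)
  have poch0: "inverse (poch0 \<psi> \<gamma> \<nu> * poch0 \<psi> triv_char \<nu>) =
      gauss0 \<psi> \<gamma> * \<gamma> (-1) / q * (gauss \<psi> (char_inv (\<gamma> \<odot> \<nu>)) * gauss \<psi> (char_inv \<nu>))"
    if "\<gamma> \<in> mult_chars" "\<nu> \<in> mult_chars" for \<gamma> \<nu>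
  proof -
    have triv: "triv_char \<odot> \<nu> = \<nu>"
      using that by (auto simp: fun_eq_iff char_mult_def triv_char_def)
    have "inverse (poch0 \<psi> \<gamma> \<nu> * poch0 \<psi> triv_char \<nu>) =
        gauss0 \<psi> \<gamma> * q * (inverse (gauss0 \<psi> (\<gamma> \<odot> \<nu>)) * inverse (gauss0 \<psi> \<nu>))"
      unfolding poch0_def triv by (simp add: gauss0_def[of _ triv_char] gauss_triv q_def field_simps)
    also have "\<dots> = gauss0 \<psi> \<gamma> * \<gamma> (-1) / q * (gauss \<psi> (char_inv (\<gamma> \<odot> \<nu>)) * gauss \<psi> (char_inv \<nu>)) * (\<nu> (-1) * \<nu> (-1))"
      using that \<open>q \<noteq> 0\<close> by (simp add: inverse_gauss0 char_mult_def q_def[symmetric])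
    finally show ?thesis
      using that by (simp add: mult_char_neg_one_square)
  qed
  have summand: "poch \<psi> \<alpha> (\<nu>\<^sub>1 \<odot> \<nu>\<^sub>2) * poch \<psi> \<beta> (\<nu>\<^sub>1 \<odot> \<nu>\<^sub>2) /
        (poch0 \<psi> \<gamma>\<^sub>1 \<nu>\<^sub>1 * poch0 \<psi> \<gamma>\<^sub>2 \<nu>\<^sub>2 * poch0 \<psi> triv_char \<nu>\<^sub>1 * poch0 \<psi> triv_char \<nu>\<^sub>2) * \<nu>\<^sub>1 w\<^sub>1 * \<nu>\<^sub>2 w\<^sub>2 =
      gauss0 \<psi> \<gamma>\<^sub>1 * gauss0 \<psi> \<gamma>\<^sub>2 * \<gamma>\<^sub>1 (-1) * \<gamma>\<^sub>2 (-1) / (gauss \<psi> \<alpha> * gauss \<psi> \<beta> * (of_nat CARD('k))\<^sup>2) *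
      (gauss \<psi> (\<alpha> \<odot> (\<nu>\<^sub>1 \<odot> \<nu>\<^sub>2)) * gauss \<psi> (\<beta> \<odot> (\<nu>\<^sub>1 \<odot> \<nu>\<^sub>2))
      * (gauss \<psi> (char_inv (\<gamma>\<^sub>1 \<odot> \<nu>\<^sub>1)) * gauss \<psi> (char_inv \<nu>\<^sub>1) * \<nu>\<^sub>1 w\<^sub>1)
      * (gauss \<psi> (char_inv (\<gamma>\<^sub>2 \<odot> \<nu>\<^sub>2)) * gauss \<psi> (char_inv \<nu>\<^sub>2) * \<nu>\<^sub>2 w\<^sub>2))" if \<nu>: "\<nu>\<^sub>1 \<in> mult_chars" "\<nu>\<^sub>2 \<in> mult_chars" for \<nu>\<^sub>1 \<nu>\<^sub>2
  proof -
    have "poch \<psi> \<alpha> (\<nu>\<^sub>1 \<odot> \<nu>\<^sub>2) * poch \<psi> \<beta> (\<nu>\<^sub>1 \<odot> \<nu>\<^sub>2) /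
        (poch0 \<psi> \<gamma>\<^sub>1 \<nu>\<^sub>1 * poch0 \<psi> \<gamma>\<^sub>2 \<nu>\<^sub>2 * poch0 \<psi> triv_char \<nu>\<^sub>1 * poch0 \<psi> triv_char \<nu>\<^sub>2) =
      poch \<psi> \<alpha> (\<nu>\<^sub>1 \<odot> \<nu>\<^sub>2) * poch \<psi> \<beta> (\<nu>\<^sub>1 \<odot> \<nu>\<^sub>2) *
        (inverse (poch0 \<psi> \<gamma>\<^sub>1 \<nu>\<^sub>1 * poch0 \<psi> triv_char \<nu>\<^sub>1) * inverse (poch0 \<psi> \<gamma>\<^sub>2 \<nu>\<^sub>2 * poch0 \<psi> triv_char \<nu>\<^sub>2))"
      by (simp add: divide_inverse mult_ac)
    thus ?thesis
      unfolding poch0[OF assms(3) \<nu>(1)] poch0[OF assms(4) \<nu>(2)]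
      by (simp add: poch_def power2_eq_square q_def[symmetric])
  qed
  show ?thesis
    unfolding appell_F4_def mult.assoc[of "1 / (1 - of_nat CARD('k))\<^sup>2"]
    by (rule arg_cong2[where f = "(*)", OF refl], unfold sum_distrib_left)
      (intro sum.cong refl summand)
qed

text \<open>
  The factor of \<open>J\<close> that belongs to \<open>\<gamma>\<close> is expressed through the Gauss sums that are left over in \<open>sum_gauss_eq_double_sum\<close>.
\<close>

lemma jacobi_eq_gauss:
  assumes "\<alpha> \<in> mult_chars" "\<gamma> \<in> mult_chars" "\<alpha> \<odot> char_inv \<gamma> \<noteq> triv_char"
  shows "jacobi \<alpha> (char_inv \<alpha> \<odot> \<gamma>) * (gauss0 \<psi> \<gamma> * gauss \<psi> (\<alpha> \<odot> char_inv \<gamma>)) =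
    \<alpha> (-1) * \<gamma> (-1) * of_nat CARD('k) * gauss \<psi> \<alpha>"
proof -
  have inv: "char_inv (\<alpha> \<odot> char_inv \<gamma>) = char_inv \<alpha> \<odot> \<gamma>"
    by (simp add: fun_eq_iff char_inv_def char_mult_def)
  have cancel: "\<alpha> \<odot> (char_inv \<alpha> \<odot> \<gamma>) = \<gamma>"
  proof
    fix x
    show "(\<alpha> \<odot> (char_inv \<alpha> \<odot> \<gamma>)) x = \<gamma> x"
      using assms(1,2) by (cases "x = 0") (auto simp: char_inv_def char_mult_def)
  qed
  have ne: "char_inv \<alpha> \<odot> \<gamma> \<noteq> triv_char"
    using assms by (simp add: inv[symmetric] char_inv_eq_triv_iff)
  have "gauss \<psi> \<alpha> * gauss \<psi> (char_inv \<alpha> \<odot> \<gamma>) = gauss0 \<psi> \<gamma> * jacobi \<alpha> (char_inv \<alpha> \<odot> \<gamma>)"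
    using gauss_mult_gauss_eq_jacobi[of \<alpha> "char_inv \<alpha> \<odot> \<gamma>"] assms ne by (simp add: cancel)
  hence "(gauss0 \<psi> \<gamma> * jacobi \<alpha> (char_inv \<alpha> \<odot> \<gamma>)) * gauss \<psi> (\<alpha> \<odot> char_inv \<gamma>) =
      (gauss \<psi> \<alpha> * gauss \<psi> (char_inv \<alpha> \<odot> \<gamma>)) * gauss \<psi> (\<alpha> \<odot> char_inv \<gamma>)"
    by (simp only:)
  hence "jacobi \<alpha> (char_inv \<alpha> \<odot> \<gamma>) * (gauss0 \<psi> \<gamma> * gauss \<psi> (\<alpha> \<odot> char_inv \<gamma>)) =
      gauss \<psi> (\<alpha> \<odot> char_inv \<gamma>) * gauss \<psi> (char_inv \<alpha> \<odot> \<gamma>) * gauss \<psi> \<alpha>"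
    by (simp only: mult_ac)
  also have "gauss \<psi> (\<alpha> \<odot> char_inv \<gamma>) * gauss \<psi> (char_inv \<alpha> \<odot> \<gamma>) = \<alpha> (-1) * \<gamma> (-1) * of_nat CARD('k)"
    using gauss_mult_gauss0_char_inv[of "\<alpha> \<odot> char_inv \<gamma>"] assms ne
    by (simp add: inv gauss0_def) (simp add: char_mult_def char_inv_def inverse_mult_char_neg_one)
  finally show ?thesis .
qed

text \<open>
  The Gauss sums of \<open>\<alpha>\<close>, \<open>\<beta>\<close>, \<open>\<gamma>\<^sub>i\<close>, \<open>\<alpha>/\<gamma>\<^sub>1\<close> and \<open>\<beta>/\<gamma>\<^sub>2\<close> all cancel by \<open>jacobi_eq_gauss\<close>. The signs \<open>\<gamma>\<^sub>i(-1)\<close> occur twice.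
\<close>

lemma jacobi_mult_appell_F4:
  assumes "\<alpha> \<in> mult_chars" "\<beta> \<in> mult_chars" "\<gamma>\<^sub>1 \<in> mult_chars" "\<gamma>\<^sub>2 \<in> mult_chars"
    and "\<alpha> \<odot> char_inv \<gamma>\<^sub>1 \<noteq> triv_char" "\<beta> \<odot> char_inv \<gamma>\<^sub>2 \<noteq> triv_char"
    and "w\<^sub>1 \<noteq> 0" "w\<^sub>2 \<noteq> 0"
  shows "jacobi \<alpha> (char_inv \<alpha> \<odot> \<gamma>\<^sub>1) * jacobi \<beta> (char_inv \<beta> \<odot> \<gamma>\<^sub>2) * appell_F4 \<psi> \<alpha> \<beta> \<gamma>\<^sub>1 \<gamma>\<^sub>2 w\<^sub>1 w\<^sub>2 =
    \<alpha> (-1) * \<beta> (-1) *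
    (\<Sum>u\<in>UNIV. \<Sum>v\<in>UNIV. F4_kernel \<alpha> \<beta> \<gamma>\<^sub>1 \<gamma>\<^sub>2 w\<^sub>1 w\<^sub>2 u v)"
    (is "_ = _ * ?T")
proof -
  define q where "q = (of_nat CARD('k) :: qbar)"
  define T where "T = ?T"
  have q: "q \<noteq> 0" "q - 1 \<noteq> 0"
    using card_field_ge_2[where 'k = 'k] unfolding q_def by (auto simp del: of_nat_eq_1_iff simp: of_nat_eq_1_iff)
  have g: "gauss \<psi> \<alpha> \<noteq> 0" "gauss \<psi> \<beta> \<noteq> 0"
    using assms by (simp_all add: gauss_neq_0)
  have F: "appell_F4 \<psi> \<alpha> \<beta> \<gamma>\<^sub>1 \<gamma>\<^sub>2 w\<^sub>1 w\<^sub>2 * (gauss \<psi> \<alpha> * gauss \<psi> \<beta> * q\<^sup>2) =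
    gauss0 \<psi> \<gamma>\<^sub>1 * gauss0 \<psi> \<gamma>\<^sub>2 * \<gamma>\<^sub>1 (-1) * \<gamma>\<^sub>2 (-1) * gauss \<psi> (\<alpha> \<odot> char_inv \<gamma>\<^sub>1) * gauss \<psi> (\<beta> \<odot> char_inv \<gamma>\<^sub>2) * T"
    unfolding appell_F4_eq_sum_gauss[OF assms(1-4)] sum_gauss_eq_double_sum[OF assms]
      T_def[symmetric] q_def[symmetric] power2_commute[of 1 q]
    using q g by (simp add: field_simps)
  have "jacobi \<alpha> (char_inv \<alpha> \<odot> \<gamma>\<^sub>1) * jacobi \<beta> (char_inv \<beta> \<odot> \<gamma>\<^sub>2) * appell_F4 \<psi> \<alpha> \<beta> \<gamma>\<^sub>1 \<gamma>\<^sub>2 w\<^sub>1 w\<^sub>2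
      * (gauss \<psi> \<alpha> * gauss \<psi> \<beta> * q\<^sup>2) =
    (jacobi \<alpha> (char_inv \<alpha> \<odot> \<gamma>\<^sub>1) * (gauss0 \<psi> \<gamma>\<^sub>1 * gauss \<psi> (\<alpha> \<odot> char_inv \<gamma>\<^sub>1))) *
    (jacobi \<beta> (char_inv \<beta> \<odot> \<gamma>\<^sub>2) * (gauss0 \<psi> \<gamma>\<^sub>2 * gauss \<psi> (\<beta> \<odot> char_inv \<gamma>\<^sub>2))) * \<gamma>\<^sub>1 (-1) * \<gamma>\<^sub>2 (-1) * T"
    unfolding mult.assoc[of _ _ "_ * q\<^sup>2"] F by (simp only: mult_ac)
  also have "\<dots> = \<alpha> (-1) * \<beta> (-1) * T * (gauss \<psi> \<alpha> * gauss \<psi> \<beta> * q\<^sup>2)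
      * (\<gamma>\<^sub>1 (-1) * \<gamma>\<^sub>1 (-1)) * (\<gamma>\<^sub>2 (-1) * \<gamma>\<^sub>2 (-1))"
    unfolding jacobi_eq_gauss[OF assms(1,3,5)] jacobi_eq_gauss[OF assms(2,4,6)] q_def[symmetric]
    by (simp only: mult_ac power2_eq_square)
  finally show ?thesis
    using assms(3,4) q g unfolding T_def by (simp add: mult_char_neg_one_square)
qed

end

section \<open>The change of variables\<close>

text \<open>
  The value of \<open>\<phi>\<^sub>d\<^sup>m\<close> at the right-hand side of the equation of the surface, with the zeros that come from \<open>\<eta>(0) = 0\<close>.
\<close>

definition surface_char ::
  "('k::{finite,field} \<Rightarrow> qbar) \<Rightarrow> ('k \<Rightarrow> qbar) \<Rightarrow> ('k \<Rightarrow> qbar) \<Rightarrow> ('k \<Rightarrow> qbar) \<Rightarrow> 'k \<Rightarrow> 'k \<Rightarrow> 'k \<Rightarrow> 'k \<Rightarrow> qbar" where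
  "surface_char \<alpha> \<beta> \<gamma>\<^sub>1 \<gamma>\<^sub>2 l\<^sub>1 l\<^sub>2 x y =
     \<alpha> x * \<beta> y * (char_inv \<alpha> \<odot> \<gamma>\<^sub>1) (1 - x) * (char_inv \<beta> \<odot> \<gamma>\<^sub>2) (1 - y)
     * (\<alpha> \<odot> char_inv (\<gamma>\<^sub>1 \<odot> \<gamma>\<^sub>2)) (1 - l\<^sub>1 * x) * (\<beta> \<odot> char_inv (\<gamma>\<^sub>1 \<odot> \<gamma>\<^sub>2)) (1 - l\<^sub>2 * y)
     * (char_inv (\<alpha> \<odot> \<beta>) \<odot> \<gamma>\<^sub>1 \<odot> \<gamma>\<^sub>2) (1 - l\<^sub>1 * x - l\<^sub>2 * y)"

text \<open>
  The symmetry of the situation under exchange of the two coordinates. It carries the line \<open>u = -l\<^sub>1\<close> to the line \<open>v = -l\<^sub>2\<close>.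
\<close>

lemma F4_kernel_swap: "F4_kernel \<alpha> \<beta> \<gamma>\<^sub>1 \<gamma>\<^sub>2 w\<^sub>1 w\<^sub>2 u v = F4_kernel \<beta> \<alpha> \<gamma>\<^sub>2 \<gamma>\<^sub>1 w\<^sub>2 w\<^sub>1 v u"
  by (simp add: F4_kernel_def mult_ac)

text \<open>
  At \<open>u = l\<^sub>1/t\<close>, \<open>v = l\<^sub>2t\<close> both linear factors become multiples of \<open>1 + t\<close>, and the sum has the form of \<open>jacobi_eq_sum_inverse\<close>.
\<close>

lemma sum_F4_kernel_hyperbola:
  assumes "\<alpha> \<in> mult_chars" "\<beta> \<in> mult_chars" "\<gamma>\<^sub>1 \<in> mult_chars" "\<gamma>\<^sub>2 \<in> mult_chars"
    and "l\<^sub>1 \<noteq> 0" "l\<^sub>2 \<noteq> 0"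
  shows "\<alpha> (-1) * \<beta> (-1) * (\<Sum>v\<in>UNIV. F4_kernel \<alpha> \<beta> \<gamma>\<^sub>1 \<gamma>\<^sub>2 (l\<^sub>1 * (1 - l\<^sub>2)) (l\<^sub>2 * (1 - l\<^sub>1)) (l\<^sub>1 * l\<^sub>2 / v) v)
    = - S\<^sub>0 \<alpha> \<beta> \<gamma>\<^sub>1 \<gamma>\<^sub>2 l\<^sub>1 l\<^sub>2"
proof -
  define A where "A = \<alpha> \<odot> char_inv \<gamma>\<^sub>2"
  define B where "B = \<beta> \<odot> char_inv \<gamma>\<^sub>1"
  have mem: "A \<in> mult_chars" "B \<in> mult_chars"
    using assms by (simp_all add: A_def B_def)
  have "(\<Sum>v\<in>UNIV. F4_kernel \<alpha> \<beta> \<gamma>\<^sub>1 \<gamma>\<^sub>2 (l\<^sub>1 * (1 - l\<^sub>2)) (l\<^sub>2 * (1 - l\<^sub>1)) (l\<^sub>1 * l\<^sub>2 / v) v) =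
    (\<Sum>t\<in>UNIV. char_inv \<gamma>\<^sub>1 l\<^sub>1 * char_inv \<gamma>\<^sub>2 l\<^sub>2 * (A t * inverse (A (1 + t) * B (1 + t))))"
  proof (rule sum.reindex_bij_witness[of _ "\<lambda>t. l\<^sub>2 * t" "\<lambda>v. v / l\<^sub>2"], goal_cases)
    case (5 v)
    define t where "t = v / l\<^sub>2"
    have v: "v = l\<^sub>2 * t"
      using assms by (simp add: t_def)
    show ?case
    proof (cases "t = 0")
      case False
      have 1: "1 + l\<^sub>1 / t + l\<^sub>2 * (1 - l\<^sub>1) / (l\<^sub>2 * t) = (1 + t) / t"
        using assms False by (simp add: field_simps)
      have 2: "1 + l\<^sub>2 * t + l\<^sub>1 * (1 - l\<^sub>2) / (l\<^sub>1 / t) = 1 + t"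
        using assms False by (simp add: field_simps)
      have u: "l\<^sub>1 * l\<^sub>2 / (l\<^sub>2 * t) = l\<^sub>1 / t"
        using assms by simp
      show ?thesis
        unfolding t_def[symmetric] unfolding v F4_kernel_def u 1 2 A_def B_def char_mult_def char_inv_def
        using assms False by (simp add: field_simps)
    qed (use assms mem in \<open>simp add: v F4_kernel_def\<close>)
  qed (use assms in auto)
  also have "\<dots> = - (char_inv \<gamma>\<^sub>1 l\<^sub>1 * char_inv \<gamma>\<^sub>2 l\<^sub>2 * jacobi A B)"
    unfolding jacobi_eq_sum_inverse[OF mem] sum_distrib_left[symmetric] by simp
  finally show ?thesis
    by (simp add: S\<^sub>0_def A_def B_def) (simp add: char_mult_def)
qed

text \<open>
  At \<open>u = l\<^sub>1t\<close>, \<open>v = -l\<^sub>2\<close> both linear factors become multiples of \<open>1 + t\<close>. The Jacobi sum that arises directly is \<open>jacobi A \<alpha>\<close> below;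
  \<open>jacobi_reflect\<close> brings it to the form used in \<open>S\<^sub>2\<close>.
\<close>

lemma sum_F4_kernel_line:
  assumes "\<alpha> \<in> mult_chars" "\<beta> \<in> mult_chars" "\<gamma>\<^sub>1 \<in> mult_chars" "\<gamma>\<^sub>2 \<in> mult_chars"
    and "l\<^sub>1 \<noteq> 0" "l\<^sub>2 \<noteq> 0" "l\<^sub>2 \<noteq> 1"
  shows "\<alpha> (-1) * \<beta> (-1) * (\<Sum>u\<in>UNIV. F4_kernel \<alpha> \<beta> \<gamma>\<^sub>1 \<gamma>\<^sub>2 (l\<^sub>1 * (1 - l\<^sub>2)) (l\<^sub>2 * (1 - l\<^sub>1)) u (- l\<^sub>2))
    = - S\<^sub>2 \<alpha> \<beta> \<gamma>\<^sub>1 \<gamma>\<^sub>2 l\<^sub>1 l\<^sub>2"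
proof -
  define A where "A = \<beta> \<odot> char_inv \<gamma>\<^sub>1 \<odot> char_inv \<gamma>\<^sub>2"
  define D where "D = char_inv (\<alpha> \<odot> \<beta>) \<odot> \<gamma>\<^sub>1 \<odot> \<gamma>\<^sub>2"
  define c where "c = inverse (\<alpha> l\<^sub>1) * inverse (\<gamma>\<^sub>2 (- l\<^sub>2)) * inverse (\<beta> (1 - l\<^sub>2)) * \<gamma>\<^sub>2 (1 - l\<^sub>2)"
  have mem: "A \<in> mult_chars" "D \<in> mult_chars"
    using assms by (simp_all add: A_def D_def)
  have "(\<Sum>u\<in>UNIV. F4_kernel \<alpha> \<beta> \<gamma>\<^sub>1 \<gamma>\<^sub>2 (l\<^sub>1 * (1 - l\<^sub>2)) (l\<^sub>2 * (1 - l\<^sub>1)) u (- l\<^sub>2)) =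
    (\<Sum>t\<in>UNIV. c * (A t * inverse (A (1 + t) * \<alpha> (1 + t))))"
  proof (rule sum.reindex_bij_witness[of _ "\<lambda>t. l\<^sub>1 * t" "\<lambda>u. u / l\<^sub>1"], goal_cases)
    case (5 u)
    define t where "t = u / l\<^sub>1"
    have u: "u = l\<^sub>1 * t"
      using assms by (simp add: t_def)
    show ?case
    proof (cases "t = 0")
      case False
      define s where "s = 1 + t"
      define r where "r = 1 - l\<^sub>2"
      have 1: "1 + l\<^sub>1 * t + l\<^sub>2 * (1 - l\<^sub>1) / (- l\<^sub>2) = l\<^sub>1 * s"
        using assms by (simp add: s_def field_simps)
      have 2: "1 + - l\<^sub>2 + l\<^sub>1 * r / (l\<^sub>1 * t) = r * s / t"
        using assms False by (simp add: s_def r_def field_simps)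
      have "r \<noteq> 0"
        using assms by (simp add: r_def)
      show ?thesis
        unfolding t_def[symmetric] unfolding u F4_kernel_def r_def[symmetric] s_def[symmetric] 1 2 A_def c_def
          char_mult_def char_inv_def
        using assms False \<open>r \<noteq> 0\<close> by (cases "s = 0") (simp_all add: field_simps)
    qed (use assms mem in \<open>simp add: u F4_kernel_def\<close>)
  qed (use assms in auto)
  also have "\<dots> = - (c * jacobi A \<alpha>)"
    unfolding jacobi_eq_sum_inverse[OF mem(1) assms(1)] sum_distrib_left[symmetric] by simp
  also have "jacobi A \<alpha> = \<alpha> (-1) * jacobi D \<alpha>"
  proof -
    have "char_inv (\<alpha> \<odot> A) = D"
      by (simp add: fun_eq_iff A_def D_def char_inv_def char_mult_def mult_ac)
    thus ?thesis
      using jacobi_reflect[OF assms(1) mem(1)] jacobi_commute[OF assms(1) mem(1)] jacobi_commute[OF assms(1) mem(2)]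
      by simp
  qed
  finally have "\<alpha> (-1) * \<beta> (-1) * (\<Sum>u\<in>UNIV. F4_kernel \<alpha> \<beta> \<gamma>\<^sub>1 \<gamma>\<^sub>2 (l\<^sub>1 * (1 - l\<^sub>2)) (l\<^sub>2 * (1 - l\<^sub>1)) u (- l\<^sub>2)) =
    - ((\<alpha> (-1) * \<alpha> (-1)) * (\<beta> (-1) * c) * jacobi D \<alpha>)"
    by (simp only: mult_ac mult_minus_left mult_minus_right)
  also have "\<beta> (-1) * c = char_inv \<gamma>\<^sub>2 l\<^sub>2 * (char_inv \<beta> \<odot> \<gamma>\<^sub>2) (l\<^sub>2 - 1) * char_inv \<alpha> l\<^sub>1"
  proof -
    have "inverse (\<beta> (1 - l\<^sub>2)) = \<beta> (-1) * inverse (\<beta> (l\<^sub>2 - 1))"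
      using mult_char_uminus[OF assms(2), of "l\<^sub>2 - 1"] assms(2) by (simp add: inverse_mult_char_neg_one)
    moreover have "\<gamma>\<^sub>2 (1 - l\<^sub>2) = \<gamma>\<^sub>2 (-1) * \<gamma>\<^sub>2 (l\<^sub>2 - 1)"
      using mult_char_uminus[OF assms(4), of "l\<^sub>2 - 1"] by simp
    moreover have "inverse (\<gamma>\<^sub>2 (- l\<^sub>2)) = \<gamma>\<^sub>2 (-1) * inverse (\<gamma>\<^sub>2 l\<^sub>2)"
      using mult_char_uminus[OF assms(4), of "l\<^sub>2"] assms(4) by (simp add: inverse_mult_char_neg_one)
    ultimately have "\<beta> (-1) * c = (\<beta> (-1) * \<beta> (-1)) * (\<gamma>\<^sub>2 (-1) * \<gamma>\<^sub>2 (-1)) *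
        (inverse (\<gamma>\<^sub>2 l\<^sub>2) * (inverse (\<beta> (l\<^sub>2 - 1)) * \<gamma>\<^sub>2 (l\<^sub>2 - 1)) * inverse (\<alpha> l\<^sub>1))"
      unfolding c_def by (simp only: mult_ac)
    thus ?thesis
      using assms by (simp add: mult_char_neg_one_square char_inv_def char_mult_def)
  qed
  finally show ?thesis
    using assms(1) by (simp add: S\<^sub>2_def D_def mult_char_neg_one_square mult_ac)
qed

lemma S\<^sub>1_eq_S\<^sub>2_swap: "S\<^sub>1 \<alpha> \<beta> \<gamma>\<^sub>1 \<gamma>\<^sub>2 x y = S\<^sub>2 \<beta> \<alpha> \<gamma>\<^sub>2 \<gamma>\<^sub>1 y x"
proof -
  have "char_inv (\<alpha> \<odot> \<beta>) \<odot> \<gamma>\<^sub>1 \<odot> \<gamma>\<^sub>2 = char_inv (\<beta> \<odot> \<alpha>) \<odot> \<gamma>\<^sub>2 \<odot> \<gamma>\<^sub>1"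
    by (simp add: fun_eq_iff char_mult_def char_inv_def mult_ac)
  thus ?thesis
    by (simp add: S\<^sub>1_def S\<^sub>2_def)
qed

text \<open>
  Under the substitution the linear factors of the kernel become \<open>-(1 - x)L / (xP)\<close> and \<open>-(1 - y)L / (yQ)\<close> with \<open>P = 1 - l\<^sub>1x\<close>,
  \<open>Q = 1 - l\<^sub>2y\<close> and \<open>L = 1 - l\<^sub>1x - l\<^sub>2y\<close>. The special shape of \<open>w\<^sub>1\<close> and \<open>w\<^sub>2\<close> is needed exactly for this factorization.
\<close>

lemma surface_char_eq_F4_kernel:
  assumes "\<alpha> \<in> mult_chars" "\<beta> \<in> mult_chars" "\<gamma>\<^sub>1 \<in> mult_chars" "\<gamma>\<^sub>2 \<in> mult_chars"
    and nz: "x \<noteq> 0" "y \<noteq> 0" "1 - l\<^sub>1 * x \<noteq> 0" "1 - l\<^sub>2 * y \<noteq> 0" "1 - l\<^sub>1 * x - l\<^sub>2 * y \<noteq> 0"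
  shows "surface_char \<alpha> \<beta> \<gamma>\<^sub>1 \<gamma>\<^sub>2 l\<^sub>1 l\<^sub>2 x y =
    \<alpha> (-1) * \<beta> (-1) * F4_kernel \<alpha> \<beta> \<gamma>\<^sub>1 \<gamma>\<^sub>2 (l\<^sub>1 * (1 - l\<^sub>2)) (l\<^sub>2 * (1 - l\<^sub>1))
      (- ((1 - l\<^sub>2 * y) / x)) (- ((1 - l\<^sub>1 * x) / y))"
proof -
  define P where "P = 1 - l\<^sub>1 * x"
  define Q where "Q = 1 - l\<^sub>2 * y"
  define L where "L = 1 - l\<^sub>1 * x - l\<^sub>2 * y"
  have nz': "P \<noteq> 0" "Q \<noteq> 0" "L \<noteq> 0"
    using nz by (simp_all add: P_def Q_def L_def)
  have 1: "1 + - (Q / x) + l\<^sub>2 * (1 - l\<^sub>1) / (- (P / y)) = - ((1 - x) * L / (x * P))"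
  proof -
    have "(1 + - (Q / x) + l\<^sub>2 * (1 - l\<^sub>1) / (- (P / y))) * (x * P) = (x - Q) * P - l\<^sub>2 * (1 - l\<^sub>1) * y * x"
      using nz(1,2) nz' by (simp add: field_simps)
    also have "\<dots> = - ((1 - x) * L)"
      unfolding P_def Q_def L_def by (simp add: algebra_simps)
    finally have "1 + - (Q / x) + l\<^sub>2 * (1 - l\<^sub>1) / (- (P / y)) = - ((1 - x) * L) / (x * P)"
      using nz(1) nz' by (subst nonzero_eq_divide_eq) simp_all
    thus ?thesis
      by simp
  qed
  have 2: "1 + - (P / y) + l\<^sub>1 * (1 - l\<^sub>2) / (- (Q / x)) = - ((1 - y) * L / (y * Q))"
  proof -
    have "(1 + - (P / y) + l\<^sub>1 * (1 - l\<^sub>2) / (- (Q / x))) * (y * Q) = (y - P) * Q - l\<^sub>1 * (1 - l\<^sub>2) * x * y"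
      using nz(1,2) nz' by (simp add: field_simps)
    also have "\<dots> = - ((1 - y) * L)"
      unfolding P_def Q_def L_def by (simp add: algebra_simps)
    finally have "1 + - (P / y) + l\<^sub>1 * (1 - l\<^sub>2) / (- (Q / x)) = - ((1 - y) * L) / (y * Q)"
      using nz(2) nz' by (subst nonzero_eq_divide_eq) simp_all
    thus ?thesis
      by simp
  qed
  have neg: "\<eta> (- z) = \<eta> (-1) * \<eta> z" if "\<eta> \<in> mult_chars" for \<eta> :: "'a \<Rightarrow> qbar" and z
    by (rule mult_char_uminus[OF that])
  have "F4_kernel \<alpha> \<beta> \<gamma>\<^sub>1 \<gamma>\<^sub>2 (l\<^sub>1 * (1 - l\<^sub>2)) (l\<^sub>2 * (1 - l\<^sub>1)) (- (Q / x)) (- (P / y)) =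
    (inverse (\<alpha> (-1)) * inverse (\<beta> (-1)) * (inverse (\<gamma>\<^sub>1 (-1)) * \<gamma>\<^sub>1 (-1)) * (inverse (\<gamma>\<^sub>2 (-1)) * \<gamma>\<^sub>2 (-1))) *
    (\<gamma>\<^sub>1 x / \<gamma>\<^sub>1 Q * (\<gamma>\<^sub>2 y / \<gamma>\<^sub>2 P)
      * (\<alpha> x * \<alpha> P / (\<alpha> (1 - x) * \<alpha> L) * (\<gamma>\<^sub>1 (1 - x) * \<gamma>\<^sub>1 L / (\<gamma>\<^sub>1 x * \<gamma>\<^sub>1 P)))
      * (\<beta> y * \<beta> Q / (\<beta> (1 - y) * \<beta> L) * (\<gamma>\<^sub>2 (1 - y) * \<gamma>\<^sub>2 L / (\<gamma>\<^sub>2 y * \<gamma>\<^sub>2 Q))))"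
    unfolding F4_kernel_def 1 2 char_mult_def char_inv_def neg[OF assms(1), of "_ / _"] neg[OF assms(2), of "_ / _"]
      neg[OF assms(3), of "_ / _"] neg[OF assms(4), of "_ / _"]
    using assms(1-4) by (simp add: divide_inverse mult_ac) (simp add: field_simps)
  also have "inverse (\<alpha> (-1)) * inverse (\<beta> (-1)) * (inverse (\<gamma>\<^sub>1 (-1)) * \<gamma>\<^sub>1 (-1)) * (inverse (\<gamma>\<^sub>2 (-1)) * \<gamma>\<^sub>2 (-1)) =
    inverse (\<alpha> (-1) * \<beta> (-1))"
    using assms(1-4) by simp
  also have "\<gamma>\<^sub>1 x / \<gamma>\<^sub>1 Q * (\<gamma>\<^sub>2 y / \<gamma>\<^sub>2 P)
      * (\<alpha> x * \<alpha> P / (\<alpha> (1 - x) * \<alpha> L) * (\<gamma>\<^sub>1 (1 - x) * \<gamma>\<^sub>1 L / (\<gamma>\<^sub>1 x * \<gamma>\<^sub>1 P)))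
      * (\<beta> y * \<beta> Q / (\<beta> (1 - y) * \<beta> L) * (\<gamma>\<^sub>2 (1 - y) * \<gamma>\<^sub>2 L / (\<gamma>\<^sub>2 y * \<gamma>\<^sub>2 Q))) =
    surface_char \<alpha> \<beta> \<gamma>\<^sub>1 \<gamma>\<^sub>2 l\<^sub>1 l\<^sub>2 x y"
    unfolding surface_char_def L_def[symmetric] char_mult_def char_inv_def unfolding P_def[symmetric] Q_def[symmetric]
    using assms(1-4) nz(1,2) nz' by (cases "x = 1"; cases "y = 1") (simp_all add: field_simps)
  finally show ?thesis
    unfolding P_def[symmetric] Q_def[symmetric] using assms(1,2) by (simp add: field_simps)
qed

lemma F4_kernel_0 [simp]:
  assumes "\<gamma>\<^sub>1 \<in> mult_chars" "\<gamma>\<^sub>2 \<in> mult_chars"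
  shows "F4_kernel \<alpha> \<beta> \<gamma>\<^sub>1 \<gamma>\<^sub>2 w\<^sub>1 w\<^sub>2 0 v = 0" "F4_kernel \<alpha> \<beta> \<gamma>\<^sub>1 \<gamma>\<^sub>2 w\<^sub>1 w\<^sub>2 u 0 = 0"
  using assms by (simp_all add: F4_kernel_def)

text \<open>
  The equations \<open>ux = l\<^sub>2y - 1\<close> and \<open>vy = l\<^sub>1x - 1\<close> are linear in \<open>x\<close> and \<open>y\<close> with determinant \<open>uv - l\<^sub>1l\<^sub>2\<close>, so the substitution can be inverted
  off the hyperbola. The numerators \<open>v + l\<^sub>2\<close> and \<open>u + l\<^sub>1\<close> of \<open>x\<close> and \<open>y\<close> account for the two lines.
\<close>

lemma sum_surface_char_eq_sum_F4_kernel: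
  assumes "\<alpha> \<in> mult_chars" "\<beta> \<in> mult_chars" "\<gamma>\<^sub>1 \<in> mult_chars" "\<gamma>\<^sub>2 \<in> mult_chars"
    and l: "l\<^sub>1 \<noteq> 0" "l\<^sub>2 \<noteq> 0"
  shows "(\<Sum>x\<in>UNIV. \<Sum>y\<in>UNIV. surface_char \<alpha> \<beta> \<gamma>\<^sub>1 \<gamma>\<^sub>2 l\<^sub>1 l\<^sub>2 x y) =
    \<alpha> (-1) * \<beta> (-1) * (\<Sum>u\<in>UNIV. \<Sum>v\<in>UNIV.
      if u = - l\<^sub>1 \<or> v = - l\<^sub>2 \<or> u * v = l\<^sub>1 * l\<^sub>2 then 0
      else F4_kernel \<alpha> \<beta> \<gamma>\<^sub>1 \<gamma>\<^sub>2 (l\<^sub>1 * (1 - l\<^sub>2)) (l\<^sub>2 * (1 - l\<^sub>1)) u v)"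
proof -
  define f where "f = surface_char \<alpha> \<beta> \<gamma>\<^sub>1 \<gamma>\<^sub>2 l\<^sub>1 l\<^sub>2"
  define F where "F = F4_kernel \<alpha> \<beta> \<gamma>\<^sub>1 \<gamma>\<^sub>2 (l\<^sub>1 * (1 - l\<^sub>2)) (l\<^sub>2 * (1 - l\<^sub>1))"
  define D where "D = {(x, y). x \<noteq> 0 \<and> y \<noteq> 0 \<and> 1 - l\<^sub>1 * x \<noteq> 0 \<and> 1 - l\<^sub>2 * y \<noteq> 0 \<and> 1 - l\<^sub>1 * x - l\<^sub>2 * y \<noteq> 0}"
  define E where "E = {(u, v). u \<noteq> 0 \<and> v \<noteq> 0 \<and> u \<noteq> - l\<^sub>1 \<and> v \<noteq> - l\<^sub>2 \<and> u * v \<noteq> l\<^sub>1 * l\<^sub>2}"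
  have "(\<Sum>x\<in>UNIV. \<Sum>y\<in>UNIV. f x y) = (\<Sum>(x, y)\<in>UNIV. f x y)"
    by (simp add: sum.cartesian_product)
  also have "\<dots> = (\<Sum>(x, y)\<in>D. f x y)"
    using assms by (intro sum.mono_neutral_right) (auto simp: D_def f_def surface_char_def char_mult_def char_inv_def)
  also have "\<dots> = (\<Sum>(u, v)\<in>E. \<alpha> (-1) * \<beta> (-1) * F u v)"
  proof (rule sum.reindex_bij_witness[of _
        "\<lambda>(u, v). (- (v + l\<^sub>2) / (u * v - l\<^sub>1 * l\<^sub>2), - (u + l\<^sub>1) / (u * v - l\<^sub>1 * l\<^sub>2))"
        "\<lambda>(x, y). (- ((1 - l\<^sub>2 * y) / x), - ((1 - l\<^sub>1 * x) / y))"], goal_cases)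
    case (1 a)
    obtain x y where a: "a = (x, y)"
      by (cases a)
    define L where "L = 1 - l\<^sub>1 * x - l\<^sub>2 * y"
    have nz: "x \<noteq> 0" "y \<noteq> 0" "L \<noteq> 0"
      using 1 by (auto simp: a D_def L_def)
    have det: "- ((1 - l\<^sub>2 * y) / x) * - ((1 - l\<^sub>1 * x) / y) - l\<^sub>1 * l\<^sub>2 = L / (x * y)"
      using nz(1,2) by (simp add: L_def field_simps)
    have "- (- ((1 - l\<^sub>1 * x) / y) + l\<^sub>2) / (L / (x * y)) = x"
      "- (- ((1 - l\<^sub>2 * y) / x) + l\<^sub>1) / (L / (x * y)) = y"
      using nz by (simp_all add: field_simps) (simp_all add: L_def algebra_simps)
    thus ?case
      unfolding a prod.case det by simp
  next
    case (2 a)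
    obtain x y where a: "a = (x, y)"
      by (cases a)
    define L where "L = 1 - l\<^sub>1 * x - l\<^sub>2 * y"
    have nz: "x \<noteq> 0" "y \<noteq> 0" "1 - l\<^sub>1 * x \<noteq> 0" "1 - l\<^sub>2 * y \<noteq> 0" "L \<noteq> 0"
      using 2 by (auto simp: a D_def L_def)
    define u where "u = - ((1 - l\<^sub>2 * y) / x)"
    define v where "v = - ((1 - l\<^sub>1 * x) / y)"
    have "u \<noteq> 0" "v \<noteq> 0"
      using nz by (simp_all add: u_def v_def)
    moreover have "u * v - l\<^sub>1 * l\<^sub>2 = L / (x * y)" "u + l\<^sub>1 = - L / x" "v + l\<^sub>2 = - L / y"
      using nz(1,2) by (simp_all add: u_def v_def L_def field_simps)
    hence "u * v - l\<^sub>1 * l\<^sub>2 \<noteq> 0" "u + l\<^sub>1 \<noteq> 0" "v + l\<^sub>2 \<noteq> 0"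
      using nz by simp_all
    ultimately have "(u, v) \<in> E"
      by (simp add: E_def eq_neg_iff_add_eq_0)
    thus ?case
      by (simp add: a u_def v_def)
  next
    case (3 b)
    obtain u v where b: "b = (u, v)"
      by (cases b)
    define N where "N = u * v - l\<^sub>1 * l\<^sub>2"
    have nz: "u + l\<^sub>1 \<noteq> 0" "v + l\<^sub>2 \<noteq> 0" "N \<noteq> 0"
      using 3 by (auto simp: b E_def N_def eq_neg_iff_add_eq_0)
    have xy: "1 - l\<^sub>2 * (- (u + l\<^sub>1) / N) = u * (v + l\<^sub>2) / N"
      "1 - l\<^sub>1 * (- (v + l\<^sub>2) / N) = v * (u + l\<^sub>1) / N"
      using nz(3) by (simp_all add: field_simps) (simp_all add: N_def algebra_simps)
    have cancel: "- (z * s / N / (- s / N)) = z" if "s \<noteq> 0" for z s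
      using that nz(3) by simp
    show ?case
      unfolding b prod.case N_def[symmetric] xy cancel[OF nz(1)] cancel[OF nz(2)] by (rule refl)
  next
    case (4 b)
    obtain u v where b: "b = (u, v)"
      by (cases b)
    define N where "N = u * v - l\<^sub>1 * l\<^sub>2"
    have nz: "u \<noteq> 0" "v \<noteq> 0" "u + l\<^sub>1 \<noteq> 0" "v + l\<^sub>2 \<noteq> 0" "N \<noteq> 0"
      using 4 by (auto simp: b E_def N_def eq_neg_iff_add_eq_0)
    have "1 - l\<^sub>2 * (- (u + l\<^sub>1) / N) = u * (v + l\<^sub>2) / N"
      "1 - l\<^sub>1 * (- (v + l\<^sub>2) / N) = v * (u + l\<^sub>1) / N"
      "1 - l\<^sub>1 * (- (v + l\<^sub>2) / N) - l\<^sub>2 * (- (u + l\<^sub>1) / N) = (u + l\<^sub>1) * (v + l\<^sub>2) / N"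
      using nz(5) by (simp_all add: field_simps) (simp_all add: N_def algebra_simps)
    hence "1 - l\<^sub>2 * (- (u + l\<^sub>1) / N) \<noteq> 0" "1 - l\<^sub>1 * (- (v + l\<^sub>2) / N) \<noteq> 0"
      "1 - l\<^sub>1 * (- (v + l\<^sub>2) / N) - l\<^sub>2 * (- (u + l\<^sub>1) / N) \<noteq> 0"
      using nz by (metis divide_eq_0_iff mult_eq_0_iff)+
    moreover have "- (v + l\<^sub>2) / N \<noteq> 0" "- (u + l\<^sub>1) / N \<noteq> 0"
      using nz by (simp_all only: divide_eq_0_iff neg_equal_0_iff_equal simp_thms)
    ultimately show ?case
      unfolding b D_def prod.case N_def[symmetric] mem_Collect_eq by (intro conjI)
  next
    case (5 a)
    obtain x y where a: "a = (x, y)"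
      by (cases a)
    show ?case
      using 5 unfolding a f_def F_def D_def prod.case mem_Collect_eq
      by (intro surface_char_eq_F4_kernel[symmetric] assms) simp_all
  qed
  also have "\<dots> = \<alpha> (-1) * \<beta> (-1) * (\<Sum>(u, v)\<in>E. F u v)"
    by (simp add: sum_distrib_left case_prod_unfold)
  also have "(\<Sum>(u, v)\<in>E. F u v) =
    (\<Sum>(u, v)\<in>UNIV. if u = - l\<^sub>1 \<or> v = - l\<^sub>2 \<or> u * v = l\<^sub>1 * l\<^sub>2 then 0 else F u v)"
    using assms by (intro sum.mono_neutral_cong_left) (auto simp: E_def F_def split: if_splits)
  also have "\<dots> = (\<Sum>u\<in>UNIV. \<Sum>v\<in>UNIV. if u = - l\<^sub>1 \<or> v = - l\<^sub>2 \<or> u * v = l\<^sub>1 * l\<^sub>2 then 0 else F u v)"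
    by (simp add: sum.cartesian_product)
  finally show ?thesis
    unfolding f_def F_def .
qed

text \<open>
  The excluded curves are restored one at a time. Removing each of them separately is the same as
  removing their union because they meet only at a zero of the kernel.
\<close>

lemma sum_surface_char:
  assumes "\<alpha> \<in> mult_chars" "\<beta> \<in> mult_chars" "\<gamma>\<^sub>1 \<in> mult_chars" "\<gamma>\<^sub>2 \<in> mult_chars"
    and l: "l\<^sub>1 \<noteq> 0" "l\<^sub>1 \<noteq> 1" "l\<^sub>2 \<noteq> 0" "l\<^sub>2 \<noteq> 1"
  shows "(\<Sum>x\<in>UNIV. \<Sum>y\<in>UNIV. surface_char \<alpha> \<beta> \<gamma>\<^sub>1 \<gamma>\<^sub>2 l\<^sub>1 l\<^sub>2 x y) =
    \<alpha> (-1) * \<beta> (-1) * (\<Sum>u\<in>UNIV. \<Sum>v\<in>UNIV. F4_kernel \<alpha> \<beta> \<gamma>\<^sub>1 \<gamma>\<^sub>2 (l\<^sub>1 * (1 - l\<^sub>2)) (l\<^sub>2 * (1 - l\<^sub>1)) u v)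
    + (S\<^sub>0 \<alpha> \<beta> \<gamma>\<^sub>1 \<gamma>\<^sub>2 l\<^sub>1 l\<^sub>2 + S\<^sub>1 \<alpha> \<beta> \<gamma>\<^sub>1 \<gamma>\<^sub>2 l\<^sub>1 l\<^sub>2 + S\<^sub>2 \<alpha> \<beta> \<gamma>\<^sub>1 \<gamma>\<^sub>2 l\<^sub>1 l\<^sub>2)"
proof -
  define F where "F = F4_kernel \<alpha> \<beta> \<gamma>\<^sub>1 \<gamma>\<^sub>2 (l\<^sub>1 * (1 - l\<^sub>2)) (l\<^sub>2 * (1 - l\<^sub>1))"
  define c where "c = \<alpha> (-1) * \<beta> (-1)"
  \<comment> \<open>Here \<open>1 + u + w\<^sub>2 / v = 1 - l\<^sub>1 - (1 - l\<^sub>1) = 0\<close>.\<close>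
  have centre: "F (- l\<^sub>1) (- l\<^sub>2) = 0"
    using assms by (simp add: F_def F4_kernel_def)
  have F0: "F 0 v = 0" "F u 0 = 0" for u v
    using assms by (simp_all add: F_def)
  have split: "(if u = - l\<^sub>1 \<or> v = - l\<^sub>2 \<or> u * v = l\<^sub>1 * l\<^sub>2 then 0 else F u v) =
    F u v - (if u = - l\<^sub>1 then F u v else 0) - (if v = - l\<^sub>2 then F u v else 0)
      - (if u = l\<^sub>1 * l\<^sub>2 / v then F u v else 0)" for u v
  proof (cases "v = 0")
    case True
    thus ?thesis
      by (simp add: F0)
  next
    case False
    hence "u = l\<^sub>1 * l\<^sub>2 / v \<longleftrightarrow> u * v = l\<^sub>1 * l\<^sub>2"
      by (auto simp: eq_divide_eq)
    moreover have "u = - l\<^sub>1 \<longleftrightarrow> v = - l\<^sub>2" if "u * v = l\<^sub>1 * l\<^sub>2"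
    proof
      assume "u = - l\<^sub>1"
      hence "l\<^sub>1 * (v + l\<^sub>2) = 0"
        using that by (simp add: distrib_left add_eq_0_iff)
      thus "v = - l\<^sub>2"
        using l by (simp add: eq_neg_iff_add_eq_0)
    next
      assume "v = - l\<^sub>2"
      hence "(u + l\<^sub>1) * l\<^sub>2 = 0"
        using that by (simp add: distrib_right add_eq_0_iff)
      thus "u = - l\<^sub>1"
        using l by (simp add: eq_neg_iff_add_eq_0)
    qed
    ultimately show ?thesis
      using centre by auto
  qed
  have "(\<Sum>x\<in>UNIV. \<Sum>y\<in>UNIV. surface_char \<alpha> \<beta> \<gamma>\<^sub>1 \<gamma>\<^sub>2 l\<^sub>1 l\<^sub>2 x y) =
    c * ((\<Sum>u\<in>UNIV. \<Sum>v\<in>UNIV. F u v) - (\<Sum>u\<in>UNIV. \<Sum>v\<in>UNIV. if u = - l\<^sub>1 then F u v else 0)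
      - (\<Sum>u\<in>UNIV. \<Sum>v\<in>UNIV. if v = - l\<^sub>2 then F u v else 0)
      - (\<Sum>u\<in>UNIV. \<Sum>v\<in>UNIV. if u = l\<^sub>1 * l\<^sub>2 / v then F u v else 0))"
    unfolding sum_surface_char_eq_sum_F4_kernel[OF assms(1-4) l(1,3)] F_def[symmetric] c_def[symmetric] split
    by (simp only: sum_subtractf)
  also have "(\<Sum>u\<in>UNIV. \<Sum>v\<in>UNIV. if u = - l\<^sub>1 then F u v else 0) = (\<Sum>v\<in>UNIV. F (- l\<^sub>1) v)"
    by (subst sum.swap) simp
  also have "(\<Sum>u\<in>UNIV. \<Sum>v\<in>UNIV. if v = - l\<^sub>2 then F u v else 0) = (\<Sum>u\<in>UNIV. F u (- l\<^sub>2))"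
    by simp
  also have "(\<Sum>u\<in>UNIV. \<Sum>v\<in>UNIV. if u = l\<^sub>1 * l\<^sub>2 / v then F u v else 0) = (\<Sum>v\<in>UNIV. F (l\<^sub>1 * l\<^sub>2 / v) v)"
    by (subst sum.swap) simp
  also have "c * ((\<Sum>u\<in>UNIV. \<Sum>v\<in>UNIV. F u v) - (\<Sum>v\<in>UNIV. F (- l\<^sub>1) v) - (\<Sum>u\<in>UNIV. F u (- l\<^sub>2))
      - (\<Sum>v\<in>UNIV. F (l\<^sub>1 * l\<^sub>2 / v) v)) =
    c * (\<Sum>u\<in>UNIV. \<Sum>v\<in>UNIV. F u v) - c * (\<Sum>v\<in>UNIV. F (- l\<^sub>1) v) - c * (\<Sum>u\<in>UNIV. F u (- l\<^sub>2))
      - c * (\<Sum>v\<in>UNIV. F (l\<^sub>1 * l\<^sub>2 / v) v)"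
    by (simp only: right_diff_distrib)
  also have "c * (\<Sum>v\<in>UNIV. F (- l\<^sub>1) v) = - S\<^sub>1 \<alpha> \<beta> \<gamma>\<^sub>1 \<gamma>\<^sub>2 l\<^sub>1 l\<^sub>2"
    using sum_F4_kernel_line[OF assms(2,1,4,3) l(3,1,2)]
    unfolding F_def c_def S\<^sub>1_eq_S\<^sub>2_swap F4_kernel_swap[of \<beta>] mult.commute[of "\<beta> (-1)"] .
  also have "c * (\<Sum>u\<in>UNIV. F u (- l\<^sub>2)) = - S\<^sub>2 \<alpha> \<beta> \<gamma>\<^sub>1 \<gamma>\<^sub>2 l\<^sub>1 l\<^sub>2"
    unfolding F_def c_def by (rule sum_F4_kernel_line[OF assms(1-4) l(1,3,4)])
  also have "c * (\<Sum>v\<in>UNIV. F (l\<^sub>1 * l\<^sub>2 / v) v) = - S\<^sub>0 \<alpha> \<beta> \<gamma>\<^sub>1 \<gamma>\<^sub>2 l\<^sub>1 l\<^sub>2"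
    unfolding F_def c_def by (rule sum_F4_kernel_hyperbola[OF assms(1-4) l(1,3)])
  finally show ?thesis
    unfolding F_def c_def by simp
qed

section \<open>Powers of the generator\<close>

lemma char_pow_add:
  assumes "\<eta> \<in> mult_chars"
  shows "char_pow \<eta> (i + j) = char_pow \<eta> i \<odot> char_pow \<eta> j"
  using assms by (auto simp: fun_eq_iff char_pow_def char_mult_def power_int_add)

lemma char_pow_uminus: "char_pow \<eta> (- i) = char_inv (char_pow \<eta> i)"
  by (auto simp: fun_eq_iff char_pow_def char_inv_def power_int_minus)

lemma char_pow_diff:
  assumes "\<eta> \<in> mult_chars"
  shows "char_pow \<eta> (i - j) = char_pow \<eta> i \<odot> char_inv (char_pow \<eta> j)"
  using char_pow_add[OF assms, of i "- j"] by (simp add: char_pow_uminus)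

locale generator_and_divisor =
  fixes \<phi> :: "'k::{finite,field} \<Rightarrow> qbar" and d n :: nat
  assumes generator: "char_generator \<phi>" and d_pos: "d > 0" and dn: "CARD('k) - 1 = d * n"
begin

lemma card_minus_Suc_0: "CARD('k) - Suc 0 = d * n"
  using dn by simp

definition \<phi>\<^sub>d :: "'k \<Rightarrow> qbar" where "\<phi>\<^sub>d = char_pow \<phi> (int n)"

lemma phi_mem [simp]: "\<phi> \<in> mult_chars"
  using generator by (simp add: char_generator_def)

lemma phi_d_mem [simp]: "\<phi>\<^sub>d \<in> mult_chars"
  by (simp add: \<phi>\<^sub>d_def)

lemma phi_d_eq: "\<phi>\<^sub>d x = \<phi> (x ^ n)"
proof (cases "x = 0")
  case True
  have "n > 0"
    using dn card_field_ge_2[where 'k = 'k] by (auto intro!: Nat.gr0I)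
  thus ?thesis
    using True by (simp add: \<phi>\<^sub>d_def char_pow_def)
qed (simp add: \<phi>\<^sub>d_def char_pow_def)

lemma phi_d_power_d:
  assumes "x \<noteq> 0"
  shows "\<phi>\<^sub>d x ^ d = 1"
proof -
  have "\<phi>\<^sub>d x ^ d = \<phi> (x ^ (CARD('k) - 1))"
    unfolding phi_d_eq dn by (simp add: mult.commute power_mult flip: power_mult)
  thus ?thesis
    unfolding power_card_minus_1[OF assms] by simp
qed

lemma phi_d_powi_eq_1:
  assumes "x \<noteq> 0" and "int d dvd k"
  shows "\<phi>\<^sub>d x powi k = 1"
proof -
  obtain j where "k = int d * j"
    using assms(2) ..
  thus ?thesis
    by (simp add: power_int_mult phi_d_power_d[OF assms(1)])
qed

text \<open>
  If a generator \<open>g\<close> of the units has \<open>\<phi>(g\<^sup>k) = 1\<close>, then every character is trivial at \<open>g\<^sup>k\<close>, being a power of \<open>\<phi>\<close>.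
  Since characters separate points, \<open>g\<^sup>k = 1\<close>.
\<close>

lemma char_pow_phi_d_eq_triv_iff: "char_pow \<phi>\<^sub>d k = triv_char \<longleftrightarrow> int d dvd k"
proof
  assume "int d dvd k"
  thus "char_pow \<phi>\<^sub>d k = triv_char"
    by (auto simp: fun_eq_iff char_pow_def triv_char_def phi_d_powi_eq_1)
next
  assume triv: "char_pow \<phi>\<^sub>d k = triv_char"
  obtain g :: 'k where g: "g \<noteq> 0" "\<And>x. x \<noteq> 0 \<Longrightarrow> \<exists>i::nat. x = g ^ i"
    using finite_field_units_cyclic by blast
  define r where "r = nat (k mod int d)"
  have r: "int r = k mod int d" "r < d"
    using d_pos by (simp_all add: r_def nat_less_iff)
  have "1 = \<phi>\<^sub>d g powi k"
    using fun_cong[OF triv, of g] g(1) by (simp add: char_pow_def triv_char_def)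
  also have "\<dots> = \<phi>\<^sub>d g powi (int d * (k div int d) + int r)"
    by (simp add: r(1))
  also have "\<dots> = \<phi>\<^sub>d g ^ r"
    using g(1) by (simp add: power_int_add phi_d_powi_eq_1[OF g(1)])
  also have "\<dots> = \<phi> (g ^ (n * r))"
    by (simp add: phi_d_eq power_mult)
  finally have 1: "\<phi> (g ^ (n * r)) = 1" ..
  have "g ^ (n * r) = 1"
  proof (rule ccontr)
    assume "g ^ (n * r) \<noteq> 1"
    then obtain \<eta> :: "'k \<Rightarrow> qbar" where \<eta>: "\<eta> \<in> mult_chars" "\<eta> (g ^ (n * r)) \<noteq> 1"
      using exists_mult_char_separating[of "g ^ (n * r)"] g(1) by auto
    obtain j where "\<eta> = char_pow \<phi> j"
      using generator \<eta>(1) by (auto simp: char_generator_def)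
    hence "\<eta> (g ^ (n * r)) = \<phi> (g ^ (n * r)) powi j"
      using g(1) by (simp add: char_pow_def del: mult_char_power)
    thus False
      using \<eta>(2) unfolding 1 by simp
  qed
  hence "d * n dvd n * r"
    using primitive_power_eq_1[OF g] unfolding dn by blast
  moreover have "n > 0"
    using dn card_field_ge_2[where 'k = 'k] by (auto intro!: Nat.gr0I)
  ultimately have "d dvd r"
    by (simp add: mult.commute)
  hence "r = 0"
    using r(2) by (meson dvd_imp_le leD gr0I)
  thus "int d dvd k"
    using r(1) by auto
qed

end

section \<open>Counting points\<close>

definition surface4_rhs ::
  "(int \<Rightarrow> nat) \<Rightarrow> int \<Rightarrow> int \<Rightarrow> int \<Rightarrow> int \<Rightarrow> 'k::{finite,field} \<Rightarrow> 'k \<Rightarrow> 'k \<Rightarrow> 'k \<Rightarrow> 'k" where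
  "surface4_rhs rep a b c\<^sub>1 c\<^sub>2 l\<^sub>1 l\<^sub>2 x y =
     x ^ rep a * y ^ rep b * (1 - x) ^ rep (c\<^sub>1 - a) * (1 - y) ^ rep (c\<^sub>2 - b)
     * (1 - l\<^sub>1 * x) ^ rep (a - c\<^sub>1 - c\<^sub>2) * (1 - l\<^sub>2 * y) ^ rep (b - c\<^sub>1 - c\<^sub>2)
     * (1 - l\<^sub>1 * x - l\<^sub>2 * y) ^ rep (c\<^sub>1 + c\<^sub>2 - a - b)"

context generator_and_divisor
begin

text \<open>
  Because \<open>d\<close> divides \<open>q - 1\<close>, every \<open>d\<close>-th root of unity in the algebraic closure is fixed by Frobenius.
\<close>

lemma roots_of_unity_image: "to_ac ` (roots_of_unity d :: 'k set) = {z. z ^ d = 1}"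
proof (intro equalityI subsetI)
  fix z :: "'k alg_closure" assume "z \<in> {z. z ^ d = 1}"
  hence z: "z ^ d = 1"
    by simp
  have "z ^ CARD('k) = z * z ^ (CARD('k) - 1)"
    using power_Suc[of z "CARD('k) - 1"] by (simp only: Suc_diff_1[OF zero_less_card_finite])
  also have "\<dots> = z"
    by (simp add: card_minus_Suc_0 power_mult z)
  finally obtain \<xi> where \<xi>: "z = to_ac \<xi>"
    using frobenius_fixed_iff by blast
  have "to_ac (\<xi> ^ d) = 1"
    using z by (simp add: \<xi>)
  thus "z \<in> to_ac ` roots_of_unity d"
    unfolding \<xi> to_ac_eq_1_iff by (simp add: roots_of_unity_def)
next
  fix z :: "'k alg_closure" assume "z \<in> to_ac ` roots_of_unity d"
  then obtain \<xi> where "z = to_ac \<xi>" "\<xi> ^ d = 1"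
    by (auto simp: roots_of_unity_def)
  thus "z \<in> {z. z ^ d = 1}"
    using to_ac_power[of \<xi> d] by simp
qed

lemma of_nat_d_neq_0: "of_nat d \<noteq> (0 :: 'k alg_closure)"
proof -
  have "of_nat d \<noteq> (0 :: 'k)"
    by (rule of_nat_dvd_card_minus_1_neq_0) (simp add: card_minus_Suc_0)
  thus ?thesis
    by (metis to_ac_eq_0_iff to_ac_of_nat)
qed

lemma card_roots_of_unity: "card (roots_of_unity d :: 'k set) = d"
proof -
  have "card (roots_of_unity d :: 'k set) = card (to_ac ` (roots_of_unity d :: 'k set))"
    by (rule card_image[symmetric]) (rule inj_on_subset[OF inj_to_ac subset_UNIV])
  also have "\<dots> = d"
    unfolding roots_of_unity_image using d_pos of_nat_d_neq_0 by (intro card_roots_of_power_eq) auto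
  finally show ?thesis .
qed

lemma sum_roots_of_unity:
  "(\<Sum>\<xi>\<in>roots_of_unity d. \<phi> \<xi> powi m) = (if int d dvd m then of_nat d else 0)"
proof (cases "int d dvd m")
  case True
  have "\<phi> \<xi> powi m = 1" if "\<xi> \<in> roots_of_unity d" for \<xi>
  proof -
    have "\<phi> \<xi> ^ d = \<phi> (\<xi> ^ d)"
      by simp
    also have "\<dots> = 1"
      using that by (simp add: roots_of_unity_def del: mult_char_power)
    finally show ?thesis
      using True by (auto simp: power_int_mult elim!: dvdE)
  qed
  thus ?thesis
    using True by (simp add: card_roots_of_unity)
next
  case False
  then obtain g where g: "char_pow \<phi>\<^sub>d m g \<noteq> triv_char g"
    using char_pow_phi_d_eq_triv_iff by blast
  hence g0: "g \<noteq> 0"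
    by (auto simp: char_pow_def triv_char_def)
  define \<zeta> where "\<zeta> = g ^ n"
  have "\<zeta> \<noteq> 0" "\<phi> \<zeta> powi m \<noteq> 1"
    using g g0 by (simp_all add: \<zeta>_def char_pow_def triv_char_def phi_d_eq del: mult_char_power)
  have "\<zeta> ^ d = g ^ (CARD('k) - 1)"
    by (simp add: \<zeta>_def card_minus_Suc_0 mult.commute flip: power_mult)
  hence \<zeta>: "\<zeta> ^ d = 1"
    by (simp only: power_card_minus_1[OF g0])
  have "(\<Sum>\<xi>\<in>roots_of_unity d. \<phi> \<xi> powi m) = (\<Sum>\<xi>\<in>roots_of_unity d. \<phi> (\<zeta> * \<xi>) powi m)"
    by (rule sum.reindex_bij_witness[of _ "\<lambda>\<xi>. \<zeta> * \<xi>" "\<lambda>\<xi>. \<xi> / \<zeta>"])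
      (use \<zeta> \<open>\<zeta> \<noteq> 0\<close> in \<open>auto simp: roots_of_unity_def power_mult_distrib power_divide\<close>)
  also have "\<dots> = \<phi> \<zeta> powi m * (\<Sum>\<xi>\<in>roots_of_unity d. \<phi> \<xi> powi m)"
    by (simp add: power_int_mult_distrib sum_distrib_left)
  finally show ?thesis
    using False \<open>\<phi> \<zeta> powi m \<noteq> 1\<close> by (simp add: mult_cancel_right1)
qed

text \<open>
  For \<open>c \<noteq> 0\<close> every \<open>z\<close> with \<open>z\<^sup>d = c\<close> has \<open>z\<^sup>q\<^sup>-\<^sup>1 = c\<^sup>n\<close>, so all \<open>d\<close> of them belong to the same \<open>\<xi>\<close>.
\<close>

lemma sum_card_fibre:
  fixes c :: 'k
  shows "(\<Sum>\<xi>\<in>roots_of_unity d. \<phi> \<xi> powi m *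
      of_nat (card {z. z ^ d = to_ac c \<and> z ^ CARD('k) = to_ac \<xi> * z})) =
    of_nat d * (if c = 0 then (if int d dvd m then 1 else 0) else \<phi>\<^sub>d c powi m)"
proof (cases "c = 0")
  case True
  have "{z. z ^ d = to_ac c \<and> z ^ CARD('k) = to_ac \<xi> * z} = {0}" for \<xi> :: 'k
    using d_pos True by (auto simp: card_gt_0_iff)
  thus ?thesis
    using True by (simp add: sum_roots_of_unity)
next
  case False
  have mem: "c ^ n \<in> roots_of_unity d"
    using power_card_minus_1[OF False] by (simp add: roots_of_unity_def card_minus_Suc_0 mult.commute flip: power_mult)
  have fibre: "{z. z ^ d = to_ac c \<and> z ^ CARD('k) = to_ac \<xi> * z} =
      (if \<xi> = c ^ n then {z. z ^ d = to_ac c} else {})" for \<xi>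
  proof -
    have "z ^ CARD('k) = to_ac \<xi> * z \<longleftrightarrow> \<xi> = c ^ n" if z: "z ^ d = to_ac c" for z
    proof -
      have "z \<noteq> 0"
        using z False d_pos by (auto simp: power_0_left)
      have "z ^ CARD('k) = z * z ^ (CARD('k) - 1)"
        using power_Suc[of z "CARD('k) - 1"] by (simp only: Suc_diff_1[OF zero_less_card_finite])
      also have "z ^ (CARD('k) - 1) = to_ac (c ^ n)"
        by (simp add: card_minus_Suc_0 power_mult z)
      finally show ?thesis
        using \<open>z \<noteq> 0\<close> by (auto simp: mult.commute simp del: to_ac_power)
    qed
    thus ?thesis
      by auto
  qed
  have "card {z. z ^ d = to_ac c} = d"
    using d_pos of_nat_d_neq_0 False by (intro card_roots_of_power_eq) auto
  hence "\<phi> \<xi> powi m * of_nat (card {z. z ^ d = to_ac c \<and> z ^ CARD('k) = to_ac \<xi> * z}) =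
      (if \<xi> = c ^ n then \<phi> (c ^ n) powi m * of_nat d else 0)" for \<xi>
    unfolding fibre by simp
  thus ?thesis
    using mem False by (simp add: phi_d_eq mult.commute del: mult_char_power)
qed

text \<open>
  The first two coordinates of a fixed point are fixed by Frobenius, hence lie in the base field, and the points above
  them are the fibres counted in \<open>sum_card_fibre\<close>.
\<close>

lemma twisted_count_eq_sum:
  fixes P :: "'k alg_closure \<Rightarrow> 'k alg_closure \<Rightarrow> 'k alg_closure" and p :: "'k \<Rightarrow> 'k \<Rightarrow> 'k"
  assumes P: "\<And>x\<^sub>1 x\<^sub>2. P (to_ac x\<^sub>1) (to_ac x\<^sub>2) = to_ac (p x\<^sub>1 x\<^sub>2)"
    and \<theta>: "\<And>\<xi>. \<xi> \<in> roots_of_unity d \<Longrightarrow> \<theta> \<xi> = \<phi> \<xi> powi m"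
  shows "twisted_count frob3 (roots_of_unity d) mu_act 1 {(x\<^sub>1, x\<^sub>2, y). y ^ d = P x\<^sub>1 x\<^sub>2} \<theta> =
    (\<Sum>x\<^sub>1\<in>UNIV. \<Sum>x\<^sub>2\<in>UNIV. if p x\<^sub>1 x\<^sub>2 = 0 then (if int d dvd m then 1 else 0) else \<phi>\<^sub>d (p x\<^sub>1 x\<^sub>2) powi m)"
proof -
  define V where "V = {(x\<^sub>1, x\<^sub>2, y). y ^ d = P x\<^sub>1 x\<^sub>2}"
  define Z where "Z \<xi> x = {z. z ^ d = to_ac (case x of (x\<^sub>1, x\<^sub>2) \<Rightarrow> p x\<^sub>1 x\<^sub>2) \<and> z ^ CARD('k) = to_ac \<xi> * z}" for \<xi> x
  have fin: "finite (Z \<xi> x)" for \<xi> x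
    unfolding Z_def by (rule finite_subset[OF _ card_roots_of_power_le(1)[OF d_pos]]) auto
  have card: "card {x \<in> V. (frob3 ^^ 1) x = mu_act \<xi> x} = (\<Sum>x\<in>UNIV. card (Z \<xi> x))" for \<xi>
  proof -
    have "{x \<in> V. (frob3 ^^ 1) x = mu_act \<xi> x} =
        (\<lambda>((x\<^sub>1, x\<^sub>2), z). (to_ac x\<^sub>1, to_ac x\<^sub>2, z)) ` (SIGMA x:UNIV. Z \<xi> x)" (is "?A = ?B")
    proof (intro equalityI subsetI)
      fix w assume w: "w \<in> ?A"
      obtain w\<^sub>1 w\<^sub>2 z where w_eq: "w = (w\<^sub>1, w\<^sub>2, z)"
        by (cases w)
      have "w\<^sub>1 ^ CARD('k) = w\<^sub>1" "w\<^sub>2 ^ CARD('k) = w\<^sub>2" and z: "z ^ CARD('k) = to_ac \<xi> * z" "z ^ d = P w\<^sub>1 w\<^sub>2"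
        using w by (auto simp: w_eq V_def frob3_def mu_act_def)
      then obtain x\<^sub>1 x\<^sub>2 where x: "w\<^sub>1 = to_ac x\<^sub>1" "w\<^sub>2 = to_ac x\<^sub>2"
        by (auto simp: frobenius_fixed_iff)
      have "z \<in> Z \<xi> (x\<^sub>1, x\<^sub>2)"
        using z by (simp add: Z_def x P)
      thus "w \<in> ?B"
        unfolding w_eq x by force
    next
      fix w assume "w \<in> ?B"
      then obtain x\<^sub>1 x\<^sub>2 z where "w = (to_ac x\<^sub>1, to_ac x\<^sub>2, z)" "z \<in> Z \<xi> (x\<^sub>1, x\<^sub>2)"
        by auto
      thus "w \<in> ?A"
        using power_card[of x\<^sub>1] power_card[of x\<^sub>2]
        by (simp add: V_def frob3_def mu_act_def Z_def P flip: to_ac_power)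
    qed
    moreover have "inj_on (\<lambda>((x\<^sub>1, x\<^sub>2), z). (to_ac x\<^sub>1, to_ac x\<^sub>2, z)) (SIGMA x:UNIV. Z \<xi> x)"
      by (auto simp: inj_on_def)
    ultimately have "card {x \<in> V. (frob3 ^^ 1) x = mu_act \<xi> x} = card (SIGMA x:UNIV. Z \<xi> x)"
      by (simp only: card_image)
    also have "\<dots> = (\<Sum>x\<in>UNIV. card (Z \<xi> x))"
      using fin by (intro card_SigmaI) auto
    finally show ?thesis .
  qed
  have "(\<Sum>\<xi>\<in>roots_of_unity d. \<theta> \<xi> * of_nat (card {x \<in> V. (frob3 ^^ 1) x = mu_act \<xi> x})) =
    (\<Sum>\<xi>\<in>roots_of_unity d. \<Sum>x\<in>UNIV. \<phi> \<xi> powi m * of_nat (card (Z \<xi> x)))"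
    unfolding card by (simp add: \<theta> sum_distrib_left)
  also have "\<dots> = (\<Sum>x\<in>UNIV. \<Sum>\<xi>\<in>roots_of_unity d. \<phi> \<xi> powi m * of_nat (card (Z \<xi> x)))"
    by (rule sum.swap)
  also have "\<dots> = (\<Sum>(x\<^sub>1, x\<^sub>2)\<in>UNIV. of_nat d *
      (if p x\<^sub>1 x\<^sub>2 = 0 then (if int d dvd m then 1 else 0) else \<phi>\<^sub>d (p x\<^sub>1 x\<^sub>2) powi m))"
    unfolding Z_def sum_card_fibre by (rule sum.cong) (auto split: prod.split)
  also have "\<dots> = of_nat d * (\<Sum>(x\<^sub>1, x\<^sub>2)\<in>UNIV.
      if p x\<^sub>1 x\<^sub>2 = 0 then (if int d dvd m then 1 else 0) else \<phi>\<^sub>d (p x\<^sub>1 x\<^sub>2) powi m)"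
    by (simp add: sum_distrib_left case_prod_unfold)
  also have "(\<Sum>(x\<^sub>1, x\<^sub>2)\<in>UNIV.
      if p x\<^sub>1 x\<^sub>2 = 0 then (if int d dvd m then 1 else 0) else \<phi>\<^sub>d (p x\<^sub>1 x\<^sub>2) powi m) =
    (\<Sum>x\<^sub>1\<in>UNIV. \<Sum>x\<^sub>2\<in>UNIV. if p x\<^sub>1 x\<^sub>2 = 0 then (if int d dvd m then 1 else 0) else \<phi>\<^sub>d (p x\<^sub>1 x\<^sub>2) powi m)"
    by (simp add: sum.cartesian_product)
  finally show ?thesis
    unfolding twisted_count_def card_roots_of_unity V_def[symmetric] using d_pos by simp
qed

text \<open>
  For \<open>z = 0\<close> the left-hand side vanishes only if the exponent is positive: a factor with exponent \<open>0\<close> would be \<open>1\<close>, whereas the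
  right-hand side is \<open>0\<close>.
\<close>

lemma char_pow_phi_d_power:
  assumes "int d dvd int r - k" and "r > 0"
  shows "char_pow \<phi>\<^sub>d m (z ^ r) = char_pow \<phi>\<^sub>d (m * k) z"
proof (cases "z = 0")
  case True
  thus ?thesis
    using assms(2) by (simp add: char_pow_def)
next
  case False
  have "char_pow \<phi>\<^sub>d m (z ^ r) = \<phi>\<^sub>d z powi (m * (int r - k) + m * k)"
  proof -
    have "(\<phi>\<^sub>d z ^ r) powi m = \<phi>\<^sub>d z powi (int r * m)"
      by (simp add: power_int_mult)
    moreover have "m * (int r - k) + m * k = int r * m"
      by (simp add: algebra_simps)
    ultimately show ?thesis
      using False by (simp add: char_pow_def)
  qed
  also have "\<dots> = \<phi>\<^sub>d z powi (m * (int r - k)) * \<phi>\<^sub>d z powi (m * k)"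
    using False by (simp add: power_int_add)
  also have "\<phi>\<^sub>d z powi (m * (int r - k)) = 1"
    using False assms(1) by (intro phi_d_powi_eq_1) auto
  finally show ?thesis
    using False by (simp add: char_pow_def)
qed

lemma twisted_count_surface4_eq_sum:
  fixes l\<^sub>1 l\<^sub>2 :: 'k and a b c\<^sub>1 c\<^sub>2 :: int and rep :: "int \<Rightarrow> nat"
  assumes "\<And>\<xi>. \<xi> \<in> roots_of_unity d \<Longrightarrow> \<theta> \<xi> = \<phi> \<xi> powi m"
  defines "p \<equiv> surface4_rhs rep a b c\<^sub>1 c\<^sub>2 l\<^sub>1 l\<^sub>2"
  shows "twisted_count frob3 (roots_of_unity d) mu_act 1 (surface4 rep d a b c\<^sub>1 c\<^sub>2 l\<^sub>1 l\<^sub>2) \<theta> =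
    (\<Sum>x\<in>UNIV. \<Sum>y\<in>UNIV. if p x y = 0 then (if int d dvd m then 1 else 0) else \<phi>\<^sub>d (p x y) powi m)"
  unfolding surface4_def by (rule twisted_count_eq_sum) (simp_all add: assms p_def surface4_rhs_def)

lemma twisted_count_surface4_trivial:
  fixes l\<^sub>1 l\<^sub>2 :: 'k
  assumes "int d dvd m" and \<theta>: "\<And>\<xi>. \<xi> \<in> roots_of_unity d \<Longrightarrow> \<theta> \<xi> = \<phi> \<xi> powi m"
  shows "twisted_count frob3 (roots_of_unity d) mu_act 1 (surface4 rep d a b c\<^sub>1 c\<^sub>2 l\<^sub>1 l\<^sub>2) \<theta> =
    of_nat CARD('k) ^ 2"
proof -
  have "(if z = 0 then (if int d dvd m then 1 else 0) else \<phi>\<^sub>d z powi m) = 1" for z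
    using assms(1) by (simp add: phi_d_powi_eq_1)
  thus ?thesis
    using twisted_count_surface4_eq_sum[OF \<theta>] by (simp add: power2_eq_square)
qed

text \<open>
  Since \<open>\<phi>\<^sub>d\<close> has order dividing \<open>d\<close>, the exponents \<open>rep k\<close> matter only modulo \<open>d\<close>, as long as they are positive.
\<close>

lemma twisted_count_surface4:
  assumes "\<not> int d dvd m" and \<theta>: "\<And>\<xi>. \<xi> \<in> roots_of_unity d \<Longrightarrow> \<theta> \<xi> = \<phi> \<xi> powi m"
    and rep: "\<And>k. k \<in> {a, b, c\<^sub>1 - a, c\<^sub>2 - b, a - c\<^sub>1 - c\<^sub>2, b - c\<^sub>1 - c\<^sub>2, c\<^sub>1 + c\<^sub>2 - a - b} \<Longrightarrow>
      rep k > 0 \<and> int d dvd int (rep k) - k"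
  shows "twisted_count frob3 (roots_of_unity d) mu_act 1 (surface4 rep d a b c\<^sub>1 c\<^sub>2 l\<^sub>1 (l\<^sub>2 :: 'k)) \<theta> =
    (\<Sum>x\<in>UNIV. \<Sum>y\<in>UNIV. surface_char (char_pow \<phi>\<^sub>d (m * a)) (char_pow \<phi>\<^sub>d (m * b))
      (char_pow \<phi>\<^sub>d (m * c\<^sub>1)) (char_pow \<phi>\<^sub>d (m * c\<^sub>2)) l\<^sub>1 l\<^sub>2 x y)"
proof -
  define p where "p = surface4_rhs rep a b c\<^sub>1 c\<^sub>2 l\<^sub>1 l\<^sub>2"
  define \<alpha> where "\<alpha> = char_pow \<phi>\<^sub>d (m * a)"
  define \<beta> where "\<beta> = char_pow \<phi>\<^sub>d (m * b)"
  define \<gamma>\<^sub>1 where "\<gamma>\<^sub>1 = char_pow \<phi>\<^sub>d (m * c\<^sub>1)"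
  define \<gamma>\<^sub>2 where "\<gamma>\<^sub>2 = char_pow \<phi>\<^sub>d (m * c\<^sub>2)"
  have pow: "char_pow \<phi>\<^sub>d m (z ^ rep k) = char_pow \<phi>\<^sub>d (m * k) z"
    if "k \<in> {a, b, c\<^sub>1 - a, c\<^sub>2 - b, a - c\<^sub>1 - c\<^sub>2, b - c\<^sub>1 - c\<^sub>2, c\<^sub>1 + c\<^sub>2 - a - b}" for z k
    using rep[OF that] by (intro char_pow_phi_d_power) auto
  have chars: "char_pow \<phi>\<^sub>d (m * (c\<^sub>1 - a)) = char_inv \<alpha> \<odot> \<gamma>\<^sub>1"
    "char_pow \<phi>\<^sub>d (m * (c\<^sub>2 - b)) = char_inv \<beta> \<odot> \<gamma>\<^sub>2"
    "char_pow \<phi>\<^sub>d (m * (a - c\<^sub>1 - c\<^sub>2)) = \<alpha> \<odot> char_inv (\<gamma>\<^sub>1 \<odot> \<gamma>\<^sub>2)"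
    "char_pow \<phi>\<^sub>d (m * (b - c\<^sub>1 - c\<^sub>2)) = \<beta> \<odot> char_inv (\<gamma>\<^sub>1 \<odot> \<gamma>\<^sub>2)"
    "char_pow \<phi>\<^sub>d (m * (c\<^sub>1 + c\<^sub>2 - a - b)) = char_inv (\<alpha> \<odot> \<beta>) \<odot> \<gamma>\<^sub>1 \<odot> \<gamma>\<^sub>2"
    unfolding right_diff_distrib distrib_left char_pow_diff[OF phi_d_mem] char_pow_add[OF phi_d_mem]
      \<alpha>_def[symmetric] \<beta>_def[symmetric] \<gamma>\<^sub>1_def[symmetric] \<gamma>\<^sub>2_def[symmetric]
    by (simp_all add: fun_eq_iff char_mult_def char_inv_def mult_ac)
  have "twisted_count frob3 (roots_of_unity d) mu_act 1 (surface4 rep d a b c\<^sub>1 c\<^sub>2 l\<^sub>1 l\<^sub>2) \<theta> =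
    (\<Sum>x\<in>UNIV. \<Sum>y\<in>UNIV. if p x y = 0 then (if int d dvd m then 1 else 0) else \<phi>\<^sub>d (p x y) powi m)"
    unfolding p_def by (rule twisted_count_surface4_eq_sum[OF \<theta>])
  also have "\<dots> = (\<Sum>x\<in>UNIV. \<Sum>y\<in>UNIV. char_pow \<phi>\<^sub>d m (p x y))"
    using assms(1) by (intro sum.cong) (simp_all add: char_pow_def)
  also have "\<dots> = (\<Sum>x\<in>UNIV. \<Sum>y\<in>UNIV. surface_char \<alpha> \<beta> \<gamma>\<^sub>1 \<gamma>\<^sub>2 l\<^sub>1 l\<^sub>2 x y)"
    unfolding p_def surface4_rhs_def surface_char_def mult_char_mult[OF char_pow_mem[OF phi_d_mem]]
    by (simp only: pow insert_iff simp_thms chars \<alpha>_def[symmetric] \<beta>_def[symmetric])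
  finally show ?thesis
    unfolding \<alpha>_def \<beta>_def \<gamma>\<^sub>1_def \<gamma>\<^sub>2_def .
qed

end

lemma residue_properties:
  assumes "d > 0"
  shows "int d dvd int (residue d k) - k" and "\<not> int d dvd k \<Longrightarrow> residue d k > 0"
    and "int d dvd int (pos_residue d k) - k" and "pos_residue d k > 0"
proof -
  have res: "int (residue d k) = k mod int d"
    using assms by (simp add: residue_def)
  show 1: "int d dvd int (residue d k) - k"
    unfolding res by (metis dvd_minus_iff minus_diff_eq minus_mod_eq_mult_div dvd_triv_left)
  show 2: "residue d k > 0" if "\<not> int d dvd k"
    using that res by (metis dvd_eq_mod_eq_0 gr0I of_nat_0)
  show "int d dvd int (pos_residue d k) - k" "pos_residue d k > 0"
    using 1 2 assms by (auto simp: pos_residue_def)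
qed

theorem theorem4p13:
  fixes \<psi> \<phi> :: "'k::{finite,field} \<Rightarrow> qbar"
    and l\<^sub>1 l\<^sub>2 :: 'k
    and d :: nat and a b c\<^sub>1 c\<^sub>2 :: int and m :: int
  assumes "\<psi> \<in> add_chars" and "\<exists>x. \<psi> x \<noteq> 1"
    and "char_generator \<phi>"
    and "d > 0" and "a > 0" and "b > 0" and "c\<^sub>1 > 0" and "c\<^sub>2 > 0"
    and "d dvd CARD('k) - 1"
    and "l\<^sub>1 \<noteq> 0" and "l\<^sub>1 \<noteq> 1" and "l\<^sub>2 \<noteq> 0" and "l\<^sub>2 \<noteq> 1"
    and "gcd (int d) a = 1" and "gcd (int d) b = 1"
    and "gcd (int d) (c\<^sub>1 - a) = 1" and "gcd (int d) (c\<^sub>2 - a) = 1"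
    and "gcd (int d) (c\<^sub>1 - b) = 1" and "gcd (int d) (c\<^sub>2 - b) = 1"
  shows
    "let \<phi>\<^sub>d = char_pow \<phi> (int ((CARD('k) - 1) div d));
         \<mu> = (roots_of_unity d :: 'k set);
         \<chi> = restrict \<phi> \<mu>;
         N = (\<lambda>V. twisted_count frob3 \<mu> mu_act 1 V (\<lambda>\<xi>. \<chi> \<xi> powi m));
         \<alpha> = char_pow \<phi>\<^sub>d (m * a);
         \<beta> = char_pow \<phi>\<^sub>d (m * b);
         \<gamma>\<^sub>1 = char_pow \<phi>\<^sub>d (m * c\<^sub>1);
         \<gamma>\<^sub>2 = char_pow \<phi>\<^sub>d (m * c\<^sub>2);
         J = jacobi \<alpha> (char_inv \<alpha> \<odot> \<gamma>\<^sub>1) * jacobi \<beta> (char_inv \<beta> \<odot> \<gamma>\<^sub>2);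
         R = (if int d dvd m then of_nat CARD('k) ^ 2
              else J * appell_F4 \<psi> \<alpha> \<beta> \<gamma>\<^sub>1 \<gamma>\<^sub>2 (l\<^sub>1 * (1 - l\<^sub>2)) (l\<^sub>2 * (1 - l\<^sub>1))
                   + (S\<^sub>0 \<alpha> \<beta> \<gamma>\<^sub>1 \<gamma>\<^sub>2 l\<^sub>1 l\<^sub>2 + S\<^sub>1 \<alpha> \<beta> \<gamma>\<^sub>1 \<gamma>\<^sub>2 l\<^sub>1 l\<^sub>2 + S\<^sub>2 \<alpha> \<beta> \<gamma>\<^sub>1 \<gamma>\<^sub>2 l\<^sub>1 l\<^sub>2))
     in (int d dvd m \<or>
           \<not> int d dvd a - c\<^sub>1 - c\<^sub>2 \<and> \<not> int d dvd b - c\<^sub>1 - c\<^sub>2 \<and> \<not> int d dvd c\<^sub>1 + c\<^sub>2 - a - b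
           \<longrightarrow> N (surface4 (residue d) d a b c\<^sub>1 c\<^sub>2 l\<^sub>1 l\<^sub>2) = R)
        \<and> N (surface4 (pos_residue d) d a b c\<^sub>1 c\<^sub>2 l\<^sub>1 l\<^sub>2) = R"
proof -
  define n where "n = (CARD('k) - 1) div d"
  interpret psi: nontrivial_add_char \<psi>
    using assms(1,2) by unfold_locales
  interpret generator_and_divisor \<phi> d n
    using assms(3,4,9) by unfold_locales (simp_all add: n_def)
  define \<alpha> where "\<alpha> = char_pow \<phi>\<^sub>d (m * a)"
  define \<beta> where "\<beta> = char_pow \<phi>\<^sub>d (m * b)"
  define \<gamma>\<^sub>1 where "\<gamma>\<^sub>1 = char_pow \<phi>\<^sub>d (m * c\<^sub>1)"
  define \<gamma>\<^sub>2 where "\<gamma>\<^sub>2 = char_pow \<phi>\<^sub>d (m * c\<^sub>2)"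
  define \<theta> where "\<theta> = (\<lambda>\<xi>. restrict \<phi> (roots_of_unity d) \<xi> powi m)"
  have \<theta>: "\<theta> \<xi> = \<phi> \<xi> powi m" if "\<xi> \<in> roots_of_unity d" for \<xi>
    using that by (simp add: \<theta>_def)
  define N where "N rep = twisted_count frob3 (roots_of_unity d) mu_act 1 (surface4 rep d a b c\<^sub>1 c\<^sub>2 l\<^sub>1 l\<^sub>2) \<theta>" for rep
  define R where "R = (if int d dvd m then of_nat CARD('k) ^ 2
    else jacobi \<alpha> (char_inv \<alpha> \<odot> \<gamma>\<^sub>1) * jacobi \<beta> (char_inv \<beta> \<odot> \<gamma>\<^sub>2)
        * appell_F4 \<psi> \<alpha> \<beta> \<gamma>\<^sub>1 \<gamma>\<^sub>2 (l\<^sub>1 * (1 - l\<^sub>2)) (l\<^sub>2 * (1 - l\<^sub>1))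
      + (S\<^sub>0 \<alpha> \<beta> \<gamma>\<^sub>1 \<gamma>\<^sub>2 l\<^sub>1 l\<^sub>2 + S\<^sub>1 \<alpha> \<beta> \<gamma>\<^sub>1 \<gamma>\<^sub>2 l\<^sub>1 l\<^sub>2 + S\<^sub>2 \<alpha> \<beta> \<gamma>\<^sub>1 \<gamma>\<^sub>2 l\<^sub>1 l\<^sub>2))"
  have coprime_not_dvd: "\<not> int d dvd m * k" if "gcd (int d) k = 1" "\<not> int d dvd m" for k
    using that by (simp add: coprime_dvd_mult_left_iff coprime_iff_gcd_eq_1)
  have count: "N rep = R"
    if rep: "\<And>k. int d dvd int (rep k) - k"
      and pos: "\<And>k. \<not> int d dvd m \<Longrightarrow>
        k \<in> {a, b, c\<^sub>1 - a, c\<^sub>2 - b, a - c\<^sub>1 - c\<^sub>2, b - c\<^sub>1 - c\<^sub>2, c\<^sub>1 + c\<^sub>2 - a - b} \<Longrightarrow> rep k > 0" for rep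
  proof (cases "int d dvd m")
    case True
    show ?thesis
      unfolding N_def R_def if_P[OF True] by (rule twisted_count_surface4_trivial[OF True], rule \<theta>)
  next
    case False
    have mem: "\<alpha> \<in> mult_chars" "\<beta> \<in> mult_chars" "\<gamma>\<^sub>1 \<in> mult_chars" "\<gamma>\<^sub>2 \<in> mult_chars"
      by (simp_all add: \<alpha>_def \<beta>_def \<gamma>\<^sub>1_def \<gamma>\<^sub>2_def)
    have ne: "\<alpha> \<odot> char_inv \<gamma>\<^sub>1 \<noteq> triv_char" "\<beta> \<odot> char_inv \<gamma>\<^sub>2 \<noteq> triv_char"
    proof -
      have "\<not> int d dvd m * (c\<^sub>1 - a)" "\<not> int d dvd m * (c\<^sub>2 - b)"
        using assms(16,19) False by (simp_all only: coprime_not_dvd not_False_eq_True)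
      hence "\<not> int d dvd m * a - m * c\<^sub>1" "\<not> int d dvd m * b - m * c\<^sub>2"
        by (metis dvd_minus_iff minus_diff_eq right_diff_distrib)+
      thus "\<alpha> \<odot> char_inv \<gamma>\<^sub>1 \<noteq> triv_char" "\<beta> \<odot> char_inv \<gamma>\<^sub>2 \<noteq> triv_char"
        unfolding \<alpha>_def \<beta>_def \<gamma>\<^sub>1_def \<gamma>\<^sub>2_def char_pow_diff[OF phi_d_mem, symmetric] char_pow_phi_d_eq_triv_iff by simp_all
    qed
    have w: "l\<^sub>1 * (1 - l\<^sub>2) \<noteq> 0" "l\<^sub>2 * (1 - l\<^sub>1) \<noteq> 0"
      using assms(10-13) by simp_all
    have "N rep = (\<Sum>x\<in>UNIV. \<Sum>y\<in>UNIV. surface_char \<alpha> \<beta> \<gamma>\<^sub>1 \<gamma>\<^sub>2 l\<^sub>1 l\<^sub>2 x y)"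
      unfolding N_def \<alpha>_def \<beta>_def \<gamma>\<^sub>1_def \<gamma>\<^sub>2_def
      using False \<theta> rep pos by (intro twisted_count_surface4) auto
    also have "\<dots> = R"
      unfolding sum_surface_char[OF mem assms(10-13)] R_def psi.jacobi_mult_appell_F4[OF mem ne w]
      using False by simp
    finally show ?thesis .
  qed
  have "N (pos_residue d) = R"
    using assms(4) by (intro count residue_properties)
  moreover have "N (residue d) = R"
    if "int d dvd m \<or> \<not> int d dvd a - c\<^sub>1 - c\<^sub>2 \<and> \<not> int d dvd b - c\<^sub>1 - c\<^sub>2 \<and> \<not> int d dvd c\<^sub>1 + c\<^sub>2 - a - b"
  proof (intro count)
    fix k assume m: "\<not> int d dvd m"
      and k: "k \<in> {a, b, c\<^sub>1 - a, c\<^sub>2 - b, a - c\<^sub>1 - c\<^sub>2, b - c\<^sub>1 - c\<^sub>2, c\<^sub>1 + c\<^sub>2 - a - b}"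
    \<comment> \<open>The exponents \<open>a\<close>, \<open>b\<close>, \<open>c\<^sub>1 - a\<close> and \<open>c\<^sub>2 - b\<close> are prime to \<open>d\<close>, and \<open>d\<close> is not \<open>1\<close> because it does not divide \<open>m\<close>.\<close>
    have "\<not> int d dvd k"
    proof (cases "gcd (int d) k = 1")
      case True
      thus ?thesis
        using coprime_not_dvd[OF True m] by auto
    next
      case False
      thus ?thesis
        using k m that assms(14-19) by auto
    qed
    thus "residue d k > 0"
      by (rule residue_properties(2)[OF assms(4)])
  qed (rule residue_properties(1)[OF assms(4)])
  ultimately have "(int d dvd m \<or>
      \<not> int d dvd a - c\<^sub>1 - c\<^sub>2 \<and> \<not> int d dvd b - c\<^sub>1 - c\<^sub>2 \<and> \<not> int d dvd c\<^sub>1 + c\<^sub>2 - a - b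
      \<longrightarrow> N (residue d) = R) \<and> N (pos_residue d) = R"
    by blast
  thus ?thesis
    unfolding Let_def N_def R_def \<theta>_def \<alpha>_def \<beta>_def \<gamma>\<^sub>1_def \<gamma>\<^sub>2_def \<phi>\<^sub>d_def unfolding n_def .
qed

end
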